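(* Consider the following two probabilistic cellular automata on configurations $\eta_t\in\{0,1\}^{\mathbb{Z}}$, with noise parameter $p\in[0,1/2]$: (vertex noise) $\eta_{t+1}(n)=\mathrm{BSC}_p\big(\mathrm{NAND}(\eta_t(n-1),\eta_t(n))\big)$; (edge noise) $\eta_{t+1}(n)=\mathrm{NAND}\big(\mathrm{BSC}_p(\eta_t(n-1)),\mathrm{BSC}_p(\eta_t(n))\big)$, where all channel uses are independent across sites, times and edges. For each of these two PCA there exists $\epsilon>0$ such that the PCA is ergodic for every $p\in(0,\epsilon)$.
   Context: $\mathrm{BSC}_p$ (binary symmetric channel) takes a bit and flips it with probability $p$, leaving it unchanged with probability $1-p$. Given $\eta_t$, the sites of $\eta_{t+1}$ are updated independently by the stated rule; let $F$ denote the resulting Markov transition acting on probability measures on $\{0,1\}^{\mathbb{Z}}$ (product topology). The PCA is ergodic if there exists a probability measure $\mu$ with $\mu F=\mu$ such that for every probability measure $\nu$ on configurations, $\nu F^n$ converges weakly to $\mu$ as $n\to\infty$. *)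

theory Defs
  imports "HOL-Probability.Probability"
begin

type_synonym config = "int \<Rightarrow> bool"

text \<open>
  A local rule \<open>\<phi>\<close> assigns to a configuration \<open>\<eta>\<close> and a site \<open>n\<close> the law of the new state of
  site \<open>n\<close> given that the current configuration is \<open>\<eta>\<close>. The product measure in
  \<open>pca_kernel\<close> expresses that the sites are updated independently given \<open>\<eta>\<close>.
\<close>

definition pca_kernel :: "(config \<Rightarrow> int \<Rightarrow> bool pmf) \<Rightarrow> config \<Rightarrow> config measure" where
  "pca_kernel \<phi> \<eta> = PiM UNIV (\<lambda>n. measure_pmf (\<phi> \<eta> n))"

definition pca_step :: "(config \<Rightarrow> int \<Rightarrow> bool pmf) \<Rightarrow> config measure \<Rightarrow> config measure" where
  "pca_step \<phi> \<nu> = Giry_Monad.bind \<nu> (pca_kernel \<phi>)"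

definition weakly_converges ::
    "(nat \<Rightarrow> 'a::topological_space measure) \<Rightarrow> 'a measure \<Rightarrow> bool" where
  "weakly_converges M N \<longleftrightarrow>
     (\<forall>f :: 'a \<Rightarrow> real. continuous_on UNIV f \<longrightarrow> bounded (range f) \<longrightarrow>
        (\<lambda>n. integral\<^sup>L (M n) f) \<longlonglongrightarrow> integral\<^sup>L N f)"

text \<open>
  The topology on \<^typ>\<open>config\<close> is the product of the discrete topologies, so
  \<open>space (prob_algebra borel)\<close> is the set of all Borel probability measures on configurations.
\<close>

definition pca_ergodic :: "(config \<Rightarrow> int \<Rightarrow> bool pmf) \<Rightarrow> bool" where
  "pca_ergodic \<phi> \<longleftrightarrow>
     (\<exists>\<mu> \<in> space (prob_algebra borel). pca_step \<phi> \<mu> = \<mu> \<and>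
        (\<forall>\<nu> \<in> space (prob_algebra borel). weakly_converges (\<lambda>n. (pca_step \<phi> ^^ n) \<nu>) \<mu>))"

definition bsc :: "real \<Rightarrow> bool \<Rightarrow> bool pmf" where
  "bsc p b = map_pmf (\<lambda>flip. if flip then \<not> b else b) (bernoulli_pmf p)"

definition nand :: "bool \<Rightarrow> bool \<Rightarrow> bool" where
  "nand a b \<longleftrightarrow> \<not> (a \<and> b)"

definition vertex_noise :: "real \<Rightarrow> config \<Rightarrow> int \<Rightarrow> bool pmf" where
  "vertex_noise p \<eta> n = bsc p (nand (\<eta> (n - 1)) (\<eta> n))"

definition edge_noise :: "real \<Rightarrow> config \<Rightarrow> int \<Rightarrow> bool pmf" where
  "edge_noise p \<eta> n =
     map_pmf (\<lambda>(a, b). nand a b) (pair_pmf (bsc p (\<eta> (n - 1))) (bsc p (\<eta> n)))"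

text \<open>
  The monadic bind on measures is only meaningful for measurable kernels; the following lemmas
  show that both automata have measurable kernels with respect to the Borel sigma-algebra.
\<close>

instance bool :: second_countable_topology
proof
  have "generate_topology UNIV = (open :: bool set \<Rightarrow> bool)"
    by (intro ext iffI) (rule discrete_topology_class.open_discrete, rule generate_topology.Basis, rule UNIV_I)
  then show "\<exists>B :: bool set set. countable B \<and> open = generate_topology B"
    by (metis countable_finite finite)
qed

lemma sets_PiM_pmf_borel:
  "sets (PiM UNIV (\<lambda>n::int. measure_pmf (q n :: bool pmf))) = sets (borel :: config measure)"
proof -
  have "sets (PiM UNIV (\<lambda>n::int. measure_pmf (q n))) = sets (PiM UNIV (\<lambda>n::int. borel :: bool measure))"
    by (intro sets_PiM_cong) (auto simp: sets_borel_eq_count_space)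
  then show ?thesis
    by (simp add: sets_PiM_equal_borel)
qed

lemma sets_pca_kernel: "sets (pca_kernel \<phi> \<eta>) = sets borel"
  unfolding pca_kernel_def by (rule sets_PiM_pmf_borel)

lemma prob_space_pca_kernel: "prob_space (pca_kernel \<phi> \<eta>)"
  unfolding pca_kernel_def by (intro prob_space_PiM) (rule prob_space_measure_pmf)

lemma measurable_pca_kernel:
  fixes \<phi> :: "config \<Rightarrow> int \<Rightarrow> bool pmf"
  assumes "\<And>n. (\<lambda>\<eta>. \<phi> \<eta> n) \<in> borel \<rightarrow>\<^sub>M count_space UNIV"
  shows "pca_kernel \<phi> \<in> borel \<rightarrow>\<^sub>M prob_algebra borel"
proof (rule measurable_prob_algebra_generated)
  let ?M = "\<lambda>_::int. count_space UNIV :: bool measure"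
  have "sets (borel :: config measure) = sets (PiM UNIV ?M)"
    using sets_PiM_pmf_borel[of "\<lambda>_. return_pmf True"]
      sets_PiM_cong[of UNIV UNIV "\<lambda>_. measure_pmf (return_pmf True)" ?M] by simp
  then show "sets (borel :: config measure) = sigma_sets (\<Pi>\<^sub>E i\<in>UNIV. space (?M i)) (prod_algebra UNIV ?M)"
    by (simp add: sets_PiM)
  show "Int_stable (prod_algebra UNIV ?M)"
    by (rule Int_stable_prod_algebra)
  show "prod_algebra UNIV ?M \<subseteq> Pow (\<Pi>\<^sub>E i\<in>UNIV. space (?M i))"
    by (rule prod_algebra_sets_into_space)
  show "prob_space (pca_kernel \<phi> \<eta>)" for \<eta>
    by (rule prob_space_pca_kernel)
  show "sets (pca_kernel \<phi> \<eta>) = sets borel" for \<eta>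
    by (rule sets_pca_kernel)
  fix A assume "A \<in> prod_algebra UNIV ?M"
  then obtain J E where A: "A = prod_emb UNIV ?M J (Pi\<^sub>E J E)" "finite J"
    by (auto simp: prod_algebra_def)
  have "emeasure (pca_kernel \<phi> \<eta>) A = (\<Prod>n\<in>J. emeasure (measure_pmf (\<phi> \<eta> n)) (E n))" for \<eta>
  proof -
    interpret product_prob_space "\<lambda>n. measure_pmf (\<phi> \<eta> n)" UNIV
      by unfold_locales
    have "A = emb UNIV J (Pi\<^sub>E J E)"
      by (simp add: A prod_emb_def)
    then show ?thesis
      using emeasure_PiM_emb[of J E] A by (simp add: pca_kernel_def)
  qed
  moreover have "(\<lambda>\<eta>. emeasure (measure_pmf (\<phi> \<eta> n)) (E n)) \<in> borel_measurable borel" for n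
    using measurable_compose[OF assms[of n], of "\<lambda>q. emeasure (measure_pmf q) (E n)" borel] by simp
  ultimately show "(\<lambda>\<eta>. emeasure (pca_kernel \<phi> \<eta>) A) \<in> borel_measurable borel"
    by simp
qed

lemma measurable_two_sites:
  fixes g :: "bool \<Rightarrow> bool \<Rightarrow> 'a"
  shows "(\<lambda>\<eta> :: config. g (\<eta> m) (\<eta> n)) \<in> borel \<rightarrow>\<^sub>M count_space UNIV"
proof -
  have coord: "(\<lambda>\<eta> :: config. \<eta> k) \<in> borel \<rightarrow>\<^sub>M count_space UNIV" for k
  proof -
    have "(\<lambda>\<eta> :: config. \<eta> k) \<in> borel \<rightarrow>\<^sub>M borel"
      by (intro borel_measurable_continuous_onI continuous_on_product_coordinates)
    also have "(borel :: config measure) \<rightarrow>\<^sub>M (borel :: bool measure) = borel \<rightarrow>\<^sub>M count_space UNIV"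
      by (intro measurable_cong_sets) (auto simp: sets_borel_eq_count_space)
    finally show ?thesis .
  qed
  have "(\<lambda>\<eta> :: config. (\<eta> m, \<eta> n)) \<in> borel \<rightarrow>\<^sub>M count_space UNIV"
    using measurable_Pair[OF coord[of m] coord[of n]] by (simp add: pair_measure_countable)
  from measurable_compose[OF this, of "\<lambda>(a, b). g a b" "count_space UNIV"] show ?thesis
    by simp
qed

lemma measurable_vertex_noise: "pca_kernel (vertex_noise p) \<in> borel \<rightarrow>\<^sub>M prob_algebra borel"
  unfolding vertex_noise_def[abs_def] by (intro measurable_pca_kernel measurable_two_sites)

lemma measurable_edge_noise: "pca_kernel (edge_noise p) \<in> borel \<rightarrow>\<^sub>M prob_algebra borel"
  unfolding edge_noise_def[abs_def]
  by (intro measurable_pca_kernel)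
     (rule measurable_two_sites[where g = "\<lambda>a b. map_pmf (\<lambda>(a, b). nand a b) (pair_pmf (bsc p a) (bsc p b))"])

end

theory Submission
  imports Defs
begin

text \<open>
  Write both automata with i.i.d. noise that forces a bit (an output for vertex noise, an input for edge
  noise) to \<open>0\<close> or to \<open>1\<close> with probability \<open>p\<close> each. Running the same noise on configurations over
  \<open>{0, ?, 1}\<close>, started from all \<open>?\<close>, gives an envelope: a site that is not \<open>?\<close> at time \<open>n\<close> has the same
  value for every initial configuration. So it suffices that the density of \<open>?\<close> tends to \<open>0\<close>.

  The law of the envelope is shift invariant at all times, so the expectation of a function of three
  neighbouring sites is not affected by adding a coboundary \<open>h (b, c, d) - h (a, b, c)\<close>. Up to such a
  coboundary, a weighted count of the patterns \<open>?\<close>, \<open>1?\<close>, \<open>01?\<close>, \<open>10?\<close> and their mirror images loses at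
  least a fixed multiple of the density of \<open>?\<close> in every step (of order \<open>p\<close> for vertex noise, but only
  \<open>p\<^sup>2\<close> for edge noise). It is bounded, hence the densities of \<open>?\<close> are summable.

  The oscillation of the iterated transition operator on a function of finitely many sites then tends to
  \<open>0\<close>. The limits define a content on cylinder sets, which is countably additive by compactness; its
  extension is the invariant measure, and uniform approximation by functions of finitely many sites
  gives weak convergence.
\<close>

section \<open>Functions of finitely many sites\<close>

text \<open>Index set and alphabet stay general: the notion serves for configurations over two
  symbols, for envelopes over three, and for functions of the noise field.\<close>

definition cylindrical :: "(('i \<Rightarrow> 's) \<Rightarrow> 'b) \<Rightarrow> bool" where
  "cylindrical f \<longleftrightarrow> (\<exists>S. finite S \<and> (\<forall>x y. (\<forall>i\<in>S. x i = y i) \<longrightarrow> f x = f y))"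

lemma cylindricalI:
  "finite S \<Longrightarrow> (\<And>x y. (\<And>i. i \<in> S \<Longrightarrow> x i = y i) \<Longrightarrow> f x = f y) \<Longrightarrow> cylindrical f"
  unfolding cylindrical_def by blast

lemma cylindrical_comp2:
  assumes "cylindrical f" "cylindrical g"
  shows "cylindrical (\<lambda>x. F (f x) (g x))"
proof -
  obtain S where S: "finite S" "\<And>x y. (\<And>i. i \<in> S \<Longrightarrow> x i = y i) \<Longrightarrow> f x = f y"
    using assms(1) unfolding cylindrical_def by metis
  obtain T where T: "finite T" "\<And>x y. (\<And>i. i \<in> T \<Longrightarrow> x i = y i) \<Longrightarrow> g x = g y"
    using assms(2) unfolding cylindrical_def by metis
  show ?thesis
  proof (rule cylindricalI)
    show "finite (S \<union> T)" using S T by simp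
    fix x y :: "'a \<Rightarrow> 'b" assume "\<And>i. i \<in> S \<union> T \<Longrightarrow> x i = y i"
    then have "f x = f y" "g x = g y" by (auto intro: S T)
    then show "F (f x) (g x) = F (f y) (g y)" by simp
  qed
qed

lemma cylindrical_const: "cylindrical (\<lambda>x. c)"
  by (rule cylindricalI[of "{}"]) auto

lemma cylindrical_comp: "cylindrical f \<Longrightarrow> cylindrical (\<lambda>x. F (f x))"
  by (rule cylindrical_comp2[where g = f and F = "\<lambda>a b. F a"])

lemma cylindrical_coord: "cylindrical (\<lambda>x. x i)"
  by (rule cylindricalI[of "{i}"]) auto

lemma cylindrical_sum:
  assumes "\<And>i. i \<in> A \<Longrightarrow> cylindrical (f i)"
  shows "cylindrical (\<lambda>x. \<Sum>i\<in>A. f i x)"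
  using assms
proof (induction A rule: infinite_finite_induct)
  case (insert i A)
  then show ?case
    using cylindrical_comp2[where F = "(+)" and f = "f i" and g = "\<lambda>x. \<Sum>i\<in>A. f i x"] by auto
qed (auto intro: cylindrical_const)

lemma cylindrical_shift:
  assumes "cylindrical f"
  shows "cylindrical (\<lambda>\<eta>. f (\<lambda>i. \<eta> (i + k :: int)))"
proof -
  obtain S where S: "finite S" "\<And>x y. (\<And>i. i \<in> S \<Longrightarrow> x i = y i) \<Longrightarrow> f x = f y"
    using assms unfolding cylindrical_def by metis
  show ?thesis
    by (rule cylindricalI[of "(\<lambda>i. i + k) ` S"]) (auto intro!: S)
qed

lemma cylindrical_finite_range:
  fixes f :: "('i \<Rightarrow> 's::finite) \<Rightarrow> 'b"
  assumes "cylindrical f"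
  shows "finite (range f)"
proof -
  obtain S where S: "finite S" "\<And>x y. (\<And>i. i \<in> S \<Longrightarrow> x i = y i) \<Longrightarrow> f x = f y"
    using assms unfolding cylindrical_def by metis
  have "f x = f (restrict x S)" for x
    by (rule S) auto
  then have "range f \<subseteq> f ` PiE S (\<lambda>_. UNIV)"
    by (intro image_subsetI) (rule image_eqI[where x = "restrict x S" for x], auto)
  then show ?thesis
    by (rule finite_subset) (auto intro!: finite_imageI finite_PiE S(1))
qed

lemma cylindrical_bounded:
  fixes f :: "('i \<Rightarrow> 's::finite) \<Rightarrow> real"
  assumes "cylindrical f"
  obtains B where "\<And>x. \<bar>f x\<bar> \<le> B"
  using finite_imp_bounded[OF cylindrical_finite_range[OF assms]]
  by (auto simp: bounded_iff)

text \<open>Sort points by their pattern on \<open>S\<close>; a finite alphabet leaves finitely many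
  patterns. Measurability for product measures and openness of preimages both reduce to basic
  cylinders this way.\<close>

lemma cylindrical_vimage_eq:
  fixes f :: "('i \<Rightarrow> 's::finite) \<Rightarrow> 'b"
  assumes "cylindrical f"
  obtains S W where "finite S" "finite W" "f -` A = (\<Union>w\<in>W. {x. \<forall>i\<in>S. x i = w i})"
proof -
  obtain S where S: "finite S" "\<And>x y. (\<And>i. i \<in> S \<Longrightarrow> x i = y i) \<Longrightarrow> f x = f y"
    using assms unfolding cylindrical_def by metis
  let ?W = "(\<lambda>x. restrict x S) ` (f -` A)"
  have "?W \<subseteq> PiE S (\<lambda>_. UNIV)" by auto
  then have "finite ?W" by (rule finite_subset) (auto intro!: finite_PiE S(1))
  moreover have "f -` A = (\<Union>w\<in>?W. {x. \<forall>i\<in>S. x i = w i})"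
  proof (intro set_eqI iffI)
    fix x assume "x \<in> f -` A"
    then show "x \<in> (\<Union>w\<in>?W. {x. \<forall>i\<in>S. x i = w i})"
      by auto
  next
    fix x assume "x \<in> (\<Union>w\<in>?W. {x. \<forall>i\<in>S. x i = w i})"
    then obtain y where "f y \<in> A" "\<forall>i\<in>S. x i = y i" by auto
    then show "x \<in> f -` A" using S(2)[of x y] by auto
  qed
  ultimately show ?thesis using that S(1) by blast
qed

lemma cylindrical_measurable:
  fixes f :: "('i \<Rightarrow> 's::finite) \<Rightarrow> real"
  assumes "cylindrical f"
  shows "f \<in> borel_measurable (PiM UNIV (\<lambda>i. measure_pmf (q i)))" (is "_ \<in> borel_measurable ?M")
proof (rule measurableI)
  fix A :: "real set"
  obtain S W where W: "finite S" "finite W" "f -` A = (\<Union>w\<in>W. {x. \<forall>i\<in>S. x i = w i})"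
    by (rule cylindrical_vimage_eq[OF assms])
  have "{x \<in> space ?M. \<forall>i\<in>S. x i = w i} \<in> sets ?M" for w
  proof (rule sets.sets_Collect_finite_All[OF _ W(1)])
    fix i
    show "{x \<in> space ?M. x i = w i} \<in> sets ?M"
      by (rule sets_Collect_single[where A = "{w i}", simplified]) auto
  qed
  then show "f -` A \<inter> space ?M \<in> sets ?M"
    unfolding W by (auto simp: space_PiM intro!: sets.finite_UN W)
qed auto

section \<open>Topology of the configuration space\<close>

lemma compact_config: "compact (UNIV :: config set)"
proof -
  have "compact_space (euclidean :: bool topology)"
    by (simp add: compact_space_def finite_imp_compact)
  then have "compact_space (product_topology (\<lambda>_::int. euclidean :: bool topology) UNIV)"
    by (simp add: compact_space_product_topology)
  then show ?thesis
    unfolding euclidean_product_topology by (simp add: compact_space_def)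
qed

lemma open_cylinder:
  assumes "finite S"
  shows "open {x :: config. \<forall>i\<in>S. x i = w i}"
proof -
  have "open (PiE UNIV (\<lambda>i. if i \<in> S then {w i} else UNIV))"
  proof (rule open_PiE)
    show "finite {i. (if i \<in> S then {w i} else UNIV) \<noteq> (UNIV :: bool set)}"
      by (rule finite_subset[OF _ assms]) auto
  qed (rule discrete_topology_class.open_discrete)
  also have "PiE UNIV (\<lambda>i. if i \<in> S then {w i} else UNIV) = {x. \<forall>i\<in>S. x i = w i}"
    by (auto simp: PiE_iff split: if_splits)
  finally show ?thesis .
qed

lemma cylindrical_open_vimage:
  fixes f :: "config \<Rightarrow> 'b"
  assumes "cylindrical f" shows "open (f -` A)"
proof -
  obtain S W where W: "finite S" "finite W" "f -` A = (\<Union>w\<in>W. {x. \<forall>i\<in>S. x i = w i})"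
    by (rule cylindrical_vimage_eq[OF assms])
  then show ?thesis by (simp add: open_UN open_cylinder)
qed

lemma cylindrical_borel_measurable:
  fixes f :: "config \<Rightarrow> real"
  assumes "cylindrical f" shows "f \<in> borel_measurable borel"
  by (rule measurableI) (auto intro: borel_open cylindrical_open_vimage[OF assms])

lemma open_contains_cylinder:
  fixes x :: config
  assumes "open U" "x \<in> U"
  shows "\<exists>S. finite S \<and> (\<forall>y. (\<forall>i\<in>S. y i = x i) \<longrightarrow> y \<in> U)"
proof -
  have "openin (product_topology (\<lambda>_. euclidean) UNIV) U"
    using assms(1) by (simp add: open_fun_def)
  from product_topology_open_contains_basis[OF this assms(2)]
  obtain X where X: "x \<in> PiE UNIV X" "finite {i. X i \<noteq> UNIV}" "PiE UNIV X \<subseteq> U" by auto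
  have "y \<in> U" if "\<forall>i\<in>{i. X i \<noteq> UNIV}. y i = x i" for y
  proof -
    have "y i \<in> X i" for i
      using X(1) that by (cases "X i = UNIV") (auto simp: PiE_iff)
    then show ?thesis using X(3) by (auto simp: PiE_iff)
  qed
  with X(2) show ?thesis by blast
qed

text \<open>By compactness finitely many cylinders cover the space, with \<open>f\<close> within
  \<open>e / 2\<close> of its value at the centre on each of them. The sites used by these cylinders
  determine \<open>f\<close> up to \<open>e\<close>.\<close>

lemma continuous_cylindrical_approx:
  fixes f :: "config \<Rightarrow> real"
  assumes f: "continuous_on UNIV f" and "e > 0"
  obtains g where "cylindrical g" "\<And>x. \<bar>f x - g x\<bar> < e"
proof -
  have "\<exists>S. finite S \<and> (\<forall>y. (\<forall>i\<in>S. y i = x i) \<longrightarrow> \<bar>f y - f x\<bar> < e / 2)" for x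
  proof -
    have "open (f -` ball (f x) (e/2))"
      using f by (simp add: continuous_on_open_vimage open_vimage)
    moreover have "x \<in> f -` ball (f x) (e/2)" using \<open>e > 0\<close> by simp
    ultimately have "\<exists>S. finite S \<and> (\<forall>y. (\<forall>i\<in>S. y i = x i) \<longrightarrow> y \<in> f -` ball (f x) (e/2))"
      by (rule open_contains_cylinder)
    then show ?thesis by (simp add: dist_real_def abs_minus_commute)
  qed
  then obtain S where S: "\<And>x. finite (S x)" "\<And>x y. (\<forall>i\<in>S x. y i = x i) \<Longrightarrow> \<bar>f y - f x\<bar> < e / 2"
    by metis
  let ?U = "\<lambda>x. {y. \<forall>i\<in>S x. y i = x i}"
  have op: "open (?U x)" if "x \<in> UNIV" for x by (rule open_cylinder[OF S(1)])
  have cov: "(UNIV :: config set) \<subseteq> (\<Union>x\<in>UNIV. ?U x)" by auto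
  obtain C where "C \<subseteq> UNIV" and C: "finite C" "UNIV \<subseteq> (\<Union>x\<in>C. ?U x)"
    by (rule compactE_image[OF compact_config op cov])
  let ?T = "\<Union>x\<in>C. S x"
  \<comment> \<open>Sites outside \<open>?T\<close> are reset to \<open>False\<close>. The modified
    configuration stays in every chosen cylinder that contains \<open>x\<close>, so both values of
    \<open>f\<close> are close to the value at the same centre.\<close>
  define g where "g = (\<lambda>x. f (\<lambda>i. i \<in> ?T \<and> x i))"
  have "cylindrical g"
  proof (rule cylindricalI)
    show "finite ?T" using C S by auto
    fix x y :: config assume "\<And>i. i \<in> ?T \<Longrightarrow> x i = y i"
    then have "(\<lambda>i. i \<in> ?T \<and> x i) = (\<lambda>i. i \<in> ?T \<and> y i)" by auto
    then show "g x = g y" unfolding g_def by (rule arg_cong)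
  qed
  moreover have "\<bar>f x - g x\<bar> < e" for x
  proof -
    obtain z where z: "z \<in> C" "\<forall>i\<in>S z. x i = z i" using C(2) by blast
    have "\<bar>f x - f z\<bar> < e/2" using S(2) z by blast
    moreover have "\<bar>g x - f z\<bar> < e/2" unfolding g_def using z by (intro S(2)) auto
    ultimately show ?thesis by linarith
  qed
  ultimately show ?thesis using that by blast
qed

section \<open>Ergodicity from vanishing oscillation\<close>

abbreviation cylinder_sets :: "config set set" where
  "cylinder_sets \<equiv> {A. cylindrical (\<lambda>x. x \<in> A)}"

lemma open_cylinder_set: "A \<in> cylinder_sets \<Longrightarrow> open A"
  using cylindrical_open_vimage[of "\<lambda>x. x \<in> A" "{True}"] by (simp add: vimage_def)

lemma algebra_cylinder_sets: "algebra UNIV cylinder_sets"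
  unfolding algebra_iff_Un
  using cylindrical_const[of False] cylindrical_comp[of "\<lambda>x. x \<in> A" Not for A]
    cylindrical_comp2[of "\<lambda>x. x \<in> A" "\<lambda>x. x \<in> B" "(\<or>)" for A B]
  by auto

lemma closed_cylinder_set: "A \<in> cylinder_sets \<Longrightarrow> closed A"
  using open_cylinder_set[of "- A"] cylindrical_comp[of "\<lambda>x. x \<in> A" Not]
  by (simp add: closed_def)

text \<open>Generators of the product algebra constrain finitely many sites, and cylinder sets are
  open. Hence cylinder sets suffice for constructing a Borel measure and for comparing two of
  them.\<close>

lemma borel_eq_sigma_cylinder_sets: "sets (borel :: config measure) = sigma_sets UNIV cylinder_sets"
proof
  let ?M = "\<lambda>_::int. count_space UNIV :: bool measure"
  have "sets (borel :: config measure) = sets (PiM UNIV ?M)"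
    using sets_PiM_pmf_borel[of "\<lambda>_. return_pmf True"]
      sets_PiM_cong[of UNIV UNIV "\<lambda>_. measure_pmf (return_pmf True)" ?M] by simp
  also have "\<dots> = sigma_sets UNIV (prod_algebra UNIV ?M)"
    by (simp add: sets_PiM)
  also have "\<dots> \<subseteq> sigma_sets UNIV cylinder_sets"
  proof (rule sigma_sets_mono, rule subsetI)
    fix A assume "A \<in> prod_algebra UNIV ?M"
    then obtain J E where A: "A = prod_emb UNIV ?M J (Pi\<^sub>E J E)" "finite J"
      by (rule prod_algebraE)
    have "cylindrical (\<lambda>x. x \<in> A)"
      by (rule cylindricalI[OF A(2)]) (auto simp: A(1) prod_emb_def PiE_iff)
    then show "A \<in> sigma_sets UNIV cylinder_sets" by auto
  qed
  finally show "sets (borel :: config measure) \<subseteq> sigma_sets UNIV cylinder_sets" .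
  show "sigma_sets UNIV cylinder_sets \<subseteq> sets (borel :: config measure)"
    by (rule sets.sigma_sets_subset[of cylinder_sets borel, simplified])
       (auto intro: borel_open open_cylinder_set)
qed

text \<open>A finite range makes \<open>f\<close> a simple function over cylinder sets, so
  convergence of their measures passes to integrals.\<close>

lemma integral_cylindrical:
  fixes f :: "config \<Rightarrow> real"
  assumes f: "cylindrical f" and N: "N \<in> space (prob_algebra borel)"
  shows "integral\<^sup>L N f = (\<Sum>y\<in>range f. y * measure N (f -` {y}))"
proof -
  have fin: "finite (range f)" by (rule cylindrical_finite_range[OF f])
  interpret prob_space N using N by (simp add: space_prob_algebra)
  have sN: "sets N = sets borel" "space N = UNIV"
    using N by (auto simp: space_prob_algebra dest: sets_eq_imp_space_eq)
  have m: "f -` {y} \<in> sets N" for y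
    using cylindrical_open_vimage[OF f] by (simp add: sN borel_open)
  have "f x = (\<Sum>y\<in>range f. y * indicator (f -` {y}) x)" for x
  proof -
    have "(\<Sum>y\<in>range f. y * indicator (f -` {y}) x) = (\<Sum>y\<in>range f. if y = f x then y else 0)"
      by (intro sum.cong) (auto simp: indicator_def)
    also have "\<dots> = f x" using fin by (simp add: sum.delta')
    finally show ?thesis by simp
  qed
  then have "integral\<^sup>L N f = integral\<^sup>L N (\<lambda>x. \<Sum>y\<in>range f. y * indicator (f -` {y}) x)"
    by (intro Bochner_Integration.integral_cong refl)
  also have "\<dots> = (\<Sum>y\<in>range f. y * measure N (f -` {y}))"
    using m by (subst Bochner_Integration.integral_sum) (auto simp: emeasure_eq_measure)
  finally show ?thesis .
qed

text \<open>The limits are finitely additive on cylinder sets. Caratheodory extension also needs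
  continuity at the empty set, which compactness gives: decreasing cylinder sets are closed, so an
  empty intersection forces one of them to be empty.\<close>

lemma cylinder_limit_measure:
  fixes N :: "nat \<Rightarrow> config measure"
  assumes N: "\<And>n. N n \<in> space (prob_algebra borel)"
    and conv: "\<And>A. A \<in> cylinder_sets \<Longrightarrow> convergent (\<lambda>n. measure (N n) A)"
  shows "\<exists>\<mu>\<in>space (prob_algebra borel). \<forall>f :: config \<Rightarrow> real.
    cylindrical f \<longrightarrow> (\<lambda>n. integral\<^sup>L (N n) f) \<longlonglongrightarrow> integral\<^sup>L \<mu> f"
proof -
  interpret algebra UNIV cylinder_sets by (rule algebra_cylinder_sets)
  interpret N: prob_space "N n" for n using N by (simp add: space_prob_algebra)
  have sN: "sets (N n) = sets borel" "space (N n) = UNIV" for n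
    using N[of n] by (auto simp: space_prob_algebra dest: sets_eq_imp_space_eq)
  have mN: "A \<in> sets (N n)" if "A \<in> cylinder_sets" for A n
    using open_cylinder_set[OF that] by (simp add: sN borel_open)
  define c where "c A = lim (\<lambda>n. measure (N n) A)" for A
  have c: "(\<lambda>n. measure (N n) A) \<longlonglongrightarrow> c A" if "A \<in> cylinder_sets" for A
    using conv[OF that] by (simp add: c_def convergent_LIMSEQ_iff)
  have c_nonneg: "c A \<ge> 0" if "A \<in> cylinder_sets" for A
    by (rule LIMSEQ_le_const[OF c[OF that]]) auto
  have c_empty: "c {} = 0"
    using c[of "{}"] by (simp add: cylindrical_const LIMSEQ_const_iff)
  have c_UNIV: "c UNIV = 1"
    using c[of UNIV] N.prob_space by (simp add: sN cylindrical_const LIMSEQ_const_iff)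
  have c_add: "c (A \<union> B) = c A + c B"
    if "A \<in> cylinder_sets" "B \<in> cylinder_sets" "A \<inter> B = {}" for A B
  proof (rule LIMSEQ_unique[OF c])
    show "A \<union> B \<in> cylinder_sets" using that by (intro Un)
    have "measure (N n) (A \<union> B) = measure (N n) A + measure (N n) B" for n
      using that by (intro N.finite_measure_Union mN)
    then show "(\<lambda>n. measure (N n) (A \<union> B)) \<longlonglongrightarrow> c A + c B"
      using tendsto_add[OF c[OF that(1)] c[OF that(2)]] by simp
  qed
  have "\<exists>\<mu>. (\<forall>A\<in>cylinder_sets. \<mu> A = ennreal (c A)) \<and> measure_space UNIV (sigma_sets UNIV cylinder_sets) \<mu>"
  proof (rule caratheodory_empty_continuous)
    show "positive cylinder_sets (\<lambda>A. ennreal (c A))"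
      by (simp add: positive_def c_empty)
    show "additive cylinder_sets (\<lambda>A. ennreal (c A))"
      unfolding additive_def by (auto simp: c_add c_nonneg ennreal_plus)
    fix A :: "nat \<Rightarrow> config set"
    assume A: "range A \<subseteq> cylinder_sets" "decseq A" "(\<Inter>i. A i) = {}"
    have op: "open (- A i)" if "i \<in> UNIV" for i
      using A(1) by (auto intro!: closed_cylinder_set simp: open_closed)
    have cov: "UNIV \<subseteq> (\<Union>i\<in>UNIV. - A i)" using A(3) by auto
    obtain I where I: "finite I" "UNIV \<subseteq> (\<Union>i\<in>I. - A i)"
      by (rule compactE_image[OF compact_config op cov])
    \<comment> \<open>By monotonicity the largest index of the finite subcover works; inserting
      \<open>0\<close> keeps \<open>Max\<close> meaningful without showing that \<open>I\<close> is
      nonempty.\<close>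
    have "A (Max (insert 0 I)) = {}"
    proof -
      have "x \<notin> A (Max (insert 0 I))" for x
      proof -
        obtain i where "i \<in> I" "x \<notin> A i" using I(2) by auto
        moreover have "A (Max (insert 0 I)) \<subseteq> A i"
          using \<open>i \<in> I\<close> I(1) by (intro decseqD[OF A(2)]) auto
        ultimately show ?thesis by auto
      qed
      then show ?thesis by auto
    qed
    then have "A i = {}" if "i \<ge> Max (insert 0 I)" for i
      using decseqD[OF A(2) that] by auto
    then have "eventually (\<lambda>i. ennreal (c (A i)) = 0) sequentially"
      by (auto simp: eventually_sequentially c_empty intro!: exI[of _ "Max (insert 0 I)"])
    then show "(\<lambda>i. ennreal (c (A i))) \<longlonglongrightarrow> 0"
      by (rule tendsto_eventually)
  qed auto
  then obtain m where m: "\<forall>A\<in>cylinder_sets. m A = ennreal (c A)"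
      "measure_space UNIV (sigma_sets UNIV cylinder_sets) m" by blast
  define \<mu> where "\<mu> = measure_of UNIV cylinder_sets m"
  have s\<mu>: "sets \<mu> = sets borel" "space \<mu> = UNIV"
    by (auto simp: \<mu>_def borel_eq_sigma_cylinder_sets)
  have em: "emeasure \<mu> A = ennreal (c A)" if "A \<in> cylinder_sets" for A
  proof -
    have "emeasure \<mu> A = m A"
      unfolding \<mu>_def
    proof (rule emeasure_measure_of[OF refl])
      show "positive (sets (measure_of UNIV cylinder_sets m)) m"
        "countably_additive (sets (measure_of UNIV cylinder_sets m)) m"
        using m(2) by (auto simp: measure_space_def)
    qed (use that in auto)
    then show ?thesis using m(1) that by simp
  qed
  have \<mu>: "\<mu> \<in> space (prob_algebra borel)"
    using em[of UNIV] by (auto simp: space_prob_algebra s\<mu> c_UNIV cylindrical_const intro!: prob_spaceI)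
  have "measure \<mu> A = c A" if "A \<in> cylinder_sets" for A
    using em[OF that] c_nonneg[OF that] by (simp add: measure_def)
  then have lim: "(\<lambda>n. measure (N n) A) \<longlonglongrightarrow> measure \<mu> A" if "A \<in> cylinder_sets" for A
    using c that by simp
  have "(\<lambda>n. integral\<^sup>L (N n) f) \<longlonglongrightarrow> integral\<^sup>L \<mu> f" if f: "cylindrical f" for f :: "config \<Rightarrow> real"
    unfolding integral_cylindrical[OF f N] integral_cylindrical[OF f \<mu>]
    by (intro tendsto_sum tendsto_mult tendsto_const lim)
       (use cylindrical_comp[OF f] in \<open>simp add: vimage_def\<close>)
  with \<mu> show ?thesis by auto
qed

section \<open>Duality between the action on measures and on functions\<close>

lemma pca_step_in_prob_algebra:
  assumes "pca_kernel \<phi> \<in> borel \<rightarrow>\<^sub>M prob_algebra borel" "\<nu> \<in> space (prob_algebra borel)"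
  shows "pca_step \<phi> \<nu> \<in> space (prob_algebra borel)"
  using prob_space_bind'[OF assms(2,1)] sets_bind'[OF assms(2,1)]
  by (simp add: pca_step_def space_prob_algebra)

lemma pca_iterate_in_prob_algebra:
  assumes "pca_kernel \<phi> \<in> borel \<rightarrow>\<^sub>M prob_algebra borel" "\<nu> \<in> space (prob_algebra borel)"
  shows "(pca_step \<phi> ^^ n) \<nu> \<in> space (prob_algebra borel)"
  by (induction n) (use assms pca_step_in_prob_algebra in auto)

definition pca_operator :: "(config \<Rightarrow> int \<Rightarrow> bool pmf) \<Rightarrow> (config \<Rightarrow> real) \<Rightarrow> config \<Rightarrow> real" where
  "pca_operator \<phi> f \<eta> = integral\<^sup>L (pca_kernel \<phi> \<eta>) f"

lemma integral_pca_step: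
  assumes K: "pca_kernel \<phi> \<in> borel \<rightarrow>\<^sub>M prob_algebra borel" and \<nu>: "\<nu> \<in> space (prob_algebra borel)"
    and f: "cylindrical f"
  shows "integral\<^sup>L (pca_step \<phi> \<nu>) f = integral\<^sup>L \<nu> (pca_operator \<phi> f)"
proof -
  interpret prob_space \<nu> using \<nu> by (simp add: space_prob_algebra)
  have s: "sets \<nu> = sets borel" using \<nu> by (simp add: space_prob_algebra)
  obtain B where B: "\<And>x. \<bar>f x\<bar> \<le> B" using cylindrical_bounded[OF f] by blast
  have "integral\<^sup>L (\<nu> \<bind> pca_kernel \<phi>) f = (\<integral>\<eta>. integral\<^sup>L (pca_kernel \<phi> \<eta>) f \<partial>\<nu>)"
  proof (rule integral_bind[where K = borel and B = B and B' = 1])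
    show "pca_kernel \<phi> \<in> \<nu> \<rightarrow>\<^sub>M subprob_algebra borel"
      using measurable_prob_algebraD[OF K] by (simp add: measurable_cong_sets[OF s])
    show "AE x in \<nu>. emeasure (pca_kernel \<phi> x) (space (pca_kernel \<phi> x)) \<le> ennreal 1"
      by (simp add: prob_space.emeasure_space_1[OF prob_space_pca_kernel])
  qed (use B cylindrical_borel_measurable[OF f] finite_measure_axioms in auto)
  then show ?thesis by (simp add: pca_step_def pca_operator_def[abs_def])
qed

lemma integral_pca_iterate:
  assumes K: "pca_kernel \<phi> \<in> borel \<rightarrow>\<^sub>M prob_algebra borel" and \<nu>: "\<nu> \<in> space (prob_algebra borel)"
    and cyl: "\<And>f. cylindrical f \<Longrightarrow> cylindrical (pca_operator \<phi> f)" and f: "cylindrical f"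
  shows "integral\<^sup>L ((pca_step \<phi> ^^ n) \<nu>) f = integral\<^sup>L \<nu> ((pca_operator \<phi> ^^ n) f)"
  using f
\<comment> \<open>\<open>f\<close> has to vary: taking the last transition off the measure replaces
  \<open>f\<close> by \<open>pca_operator \<phi> f\<close>.\<close>
proof (induction n arbitrary: f)
  case (Suc n)
  have "integral\<^sup>L ((pca_step \<phi> ^^ Suc n) \<nu>) f = integral\<^sup>L ((pca_step \<phi> ^^ n) \<nu>) (pca_operator \<phi> f)"
    using integral_pca_step[OF K pca_iterate_in_prob_algebra[OF K \<nu>] Suc.prems] by simp
  also have "\<dots> = integral\<^sup>L \<nu> ((pca_operator \<phi> ^^ Suc n) f)"
    using Suc.IH[OF cyl[OF Suc.prems]] by (simp add: funpow_swap1)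
  finally show ?case .
qed simp

lemma prob_integral_close:
  fixes f :: "config \<Rightarrow> real"
  assumes "N \<in> space (prob_algebra borel)" "f \<in> borel_measurable borel" "\<And>x. \<bar>f x - a\<bar> \<le> b"
  shows "\<bar>integral\<^sup>L N f - a\<bar> \<le> b"
proof -
  interpret prob_space N using assms by (simp add: space_prob_algebra)
  have s: "sets N = sets borel" using assms by (simp add: space_prob_algebra)
  have m: "f \<in> borel_measurable N" using assms(2) by (simp add: measurable_cong_sets[OF s])
  have "\<bar>f x\<bar> \<le> \<bar>a\<bar> + b" for x using assms(3)[of x] by linarith
  then have i: "integrable N f" using m by (intro integrable_const_bound[of _ "\<bar>a\<bar> + b"]) auto
  have "integral\<^sup>L N f - a = (\<integral>x. f x - a \<partial>N)"
    using i by (simp add: prob_space)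
  also have "\<bar>\<dots>\<bar> \<le> (\<integral>x. \<bar>f x - a\<bar> \<partial>N)" by (rule integral_abs_bound)
  also have "\<dots> \<le> (\<integral>x. b \<partial>N)"
    using i assms(3) by (intro integral_mono) auto
  finally show ?thesis by (simp add: prob_space)
qed

text \<open>Seen through \<open>f\<close>, the laws at time \<open>n\<close> are nearly equal for
  all initial measures, including those already evolved for some steps. This yields both a Cauchy
  property and a common limit.\<close>

lemma pca_ergodicI:
  assumes K: "pca_kernel \<phi> \<in> borel \<rightarrow>\<^sub>M prob_algebra borel"
    and cyl: "\<And>f. cylindrical f \<Longrightarrow> cylindrical (pca_operator \<phi> f)"
    and osc: "\<And>f. cylindrical f \<Longrightarrow> \<exists>c. c \<longlonglongrightarrow> 0 \<and>
      (\<forall>n \<eta> \<eta>'. \<bar>(pca_operator \<phi> ^^ n) f \<eta> - (pca_operator \<phi> ^^ n) f \<eta>'\<bar> \<le> c n)"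
  shows "pca_ergodic \<phi>"
proof -
  let ?F = "pca_step \<phi>" and ?T = "pca_operator \<phi>"
  let ?P = "space (prob_algebra (borel :: config measure))"
  define \<eta>0 :: config where "\<eta>0 = (\<lambda>_. False)"
  define \<nu>0 where "\<nu>0 = return borel \<eta>0"
  have \<nu>0: "\<nu>0 \<in> ?P" by (simp add: \<nu>0_def space_prob_algebra prob_space_return)
  have cyln: "cylindrical ((?T ^^ n) f)" if "cylindrical f" for n f
    by (induction n) (use that cyl in auto)
  have iter: "integral\<^sup>L ((?F ^^ n) \<nu>) f = integral\<^sup>L \<nu> ((?T ^^ n) f)"
    if "\<nu> \<in> ?P" "cylindrical f" for n \<nu> f
    by (rule integral_pca_iterate) (fact K that | erule cyl)+
  have near: "\<exists>c. c \<longlonglongrightarrow> 0 \<and> (\<forall>n. \<forall>\<nu>\<in>?P. \<bar>integral\<^sup>L ((?F ^^ n) \<nu>) f - (?T ^^ n) f \<eta>0\<bar> \<le> c n)"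
    if f: "cylindrical f" for f
  proof -
    obtain c where c: "c \<longlonglongrightarrow> 0" "\<And>n \<eta> \<eta>'. \<bar>(?T ^^ n) f \<eta> - (?T ^^ n) f \<eta>'\<bar> \<le> c n"
      using osc[OF f] by blast
    have "\<bar>integral\<^sup>L ((?F ^^ n) \<nu>) f - (?T ^^ n) f \<eta>0\<bar> \<le> c n" if "\<nu> \<in> ?P" for n \<nu>
      unfolding iter[OF that f]
      by (rule prob_integral_close[OF that]) (auto intro: cylindrical_borel_measurable cyln f c)
    with c(1) show ?thesis by blast
  qed
  have cauchy: "convergent (\<lambda>n. (?T ^^ n) f \<eta>0)" if f: "cylindrical f" for f
  proof -
    obtain c where c: "c \<longlonglongrightarrow> 0"
        "\<And>n \<nu>. \<nu> \<in> ?P \<Longrightarrow> \<bar>integral\<^sup>L ((?F ^^ n) \<nu>) f - (?T ^^ n) f \<eta>0\<bar> \<le> c n"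
      using near[OF f] by blast
    \<comment> \<open>Starting from the law after \<open>k\<close> steps turns the bound uniform in
      \<nu> into a Cauchy estimate.\<close>
    have step: "\<bar>(?T ^^ (n + k)) f \<eta>0 - (?T ^^ n) f \<eta>0\<bar> \<le> c n" for n k
    proof -
      have "integral\<^sup>L ((?F ^^ n) ((?F ^^ k) \<nu>0)) f = integral\<^sup>L \<nu>0 ((?T ^^ (n + k)) f)"
        using iter[OF \<nu>0 f, of "n + k"] by (simp add: funpow_add)
      also have "\<dots> = (?T ^^ (n + k)) f \<eta>0"
        unfolding \<nu>0_def by (rule integral_return) (auto intro: cylindrical_borel_measurable cyln f)
      finally show ?thesis using c(2)[OF pca_iterate_in_prob_algebra[OF K \<nu>0], of n k] by simp
    qed
    have "Cauchy (\<lambda>n. (?T ^^ n) f \<eta>0)"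
    proof (rule metric_CauchyI)
      fix e :: real assume "e > 0"
      then obtain M where M: "\<And>n. n \<ge> M \<Longrightarrow> \<bar>c n\<bar> < e / 2"
        using c(1) by (metis half_gt_zero LIMSEQ_D real_norm_def diff_zero)
      have "\<bar>(?T ^^ m) f \<eta>0 - (?T ^^ M) f \<eta>0\<bar> < e / 2" if "m \<ge> M" for m
        using step[of M "m - M"] M[of M] that by simp
      then have "\<bar>(?T ^^ m) f \<eta>0 - (?T ^^ n) f \<eta>0\<bar> < e" if "m \<ge> M" "n \<ge> M" for m n
        by (smt (verit) that field_sum_of_halves)
      then show "\<exists>M. \<forall>m\<ge>M. \<forall>n\<ge>M. dist ((?T ^^ m) f \<eta>0) ((?T ^^ n) f \<eta>0) < e"
        by (auto simp: dist_real_def)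
    qed
    then show ?thesis by (simp add: Cauchy_convergent_iff)
  qed
  have lim: "(\<lambda>n. integral\<^sup>L ((?F ^^ n) \<nu>) f) \<longlonglongrightarrow> lim (\<lambda>n. (?T ^^ n) f \<eta>0)"
    if f: "cylindrical f" and \<nu>: "\<nu> \<in> ?P" for f \<nu>
  proof -
    obtain c where c: "c \<longlonglongrightarrow> 0" "\<And>n. \<bar>integral\<^sup>L ((?F ^^ n) \<nu>) f - (?T ^^ n) f \<eta>0\<bar> \<le> c n"
      using near[OF f] \<nu> by blast
    have "(\<lambda>n. integral\<^sup>L ((?F ^^ n) \<nu>) f - (?T ^^ n) f \<eta>0) \<longlonglongrightarrow> 0"
      using c by (intro Lim_null_comparison[OF _ c(1)]) auto
    from tendsto_add[OF this cauchy[OF f, unfolded convergent_LIMSEQ_iff]] show ?thesis by simp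
  qed
  have ind: "integral\<^sup>L \<nu> (indicator A) = measure \<nu> A" if "A \<in> cylinder_sets" "\<nu> \<in> ?P" for A \<nu>
    using that sets_eq_imp_space_eq[of \<nu> borel]
    by (auto simp: space_prob_algebra borel_open open_cylinder_set)
  have ind_cyl: "cylindrical (indicator A :: config \<Rightarrow> real)" if "A \<in> cylinder_sets" for A
    using cylindrical_comp[of "\<lambda>x. x \<in> A" of_bool] that by (simp add: indicator_def[abs_def] of_bool_def)
  note \<nu>n = pca_iterate_in_prob_algebra[OF K \<nu>0]
  have "convergent (\<lambda>n. measure ((?F ^^ n) \<nu>0) A)" if "A \<in> cylinder_sets" for A
    using lim[OF ind_cyl[OF that] \<nu>0] ind[OF that \<nu>n] by (auto simp: convergent_def)
  note c\<nu> = this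
  obtain \<mu> where \<mu>: "\<mu> \<in> ?P"
      "\<And>f :: config \<Rightarrow> real. cylindrical f \<Longrightarrow> (\<lambda>n. integral\<^sup>L ((?F ^^ n) \<nu>0) f) \<longlonglongrightarrow> integral\<^sup>L \<mu> f"
    using cylinder_limit_measure[of "\<lambda>n. (?F ^^ n) \<nu>0", OF \<nu>n c\<nu>] by auto
  have lim_eq: "lim (\<lambda>n. (?T ^^ n) f \<eta>0) = integral\<^sup>L \<mu> f" if "cylindrical f" for f
    using LIMSEQ_unique[OF lim[OF that \<nu>0] \<mu>(2)[OF that]] .
  have F\<mu>: "?F \<mu> \<in> ?P" by (rule pca_step_in_prob_algebra[OF K \<mu>(1)])
  have "?F \<mu> = \<mu>"
  proof (rule measure_eqI_generator_eq[where E = cylinder_sets and \<Omega> = UNIV and A = "\<lambda>_. UNIV"])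
    interpret algebra UNIV cylinder_sets by (rule algebra_cylinder_sets)
    show "Int_stable cylinder_sets" by (intro Int_stableI Int)
    show "sets (?F \<mu>) = sigma_sets UNIV cylinder_sets" "sets \<mu> = sigma_sets UNIV cylinder_sets"
      using F\<mu> \<mu>(1) unfolding borel_eq_sigma_cylinder_sets[symmetric]
      by (simp_all add: space_prob_algebra)
    show "range (\<lambda>_. UNIV) \<subseteq> cylinder_sets" by (simp add: cylindrical_const)
    interpret F\<mu>: prob_space "?F \<mu>" using F\<mu> by (simp add: space_prob_algebra)
    interpret \<mu>: prob_space \<mu> using \<mu>(1) by (simp add: space_prob_algebra)
    show "emeasure (?F \<mu>) UNIV \<noteq> \<infinity>" by simp
    fix A :: "config set" assume A: "A \<in> cylinder_sets"
    \<comment> \<open>\<open>?T (indicator A)\<close> also depends on finitely many sites, so its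
      integrals converge. By duality they are the integrals of \<open>indicator A\<close> one step
      later, and uniqueness of the limit gives invariance on \<open>A\<close>.\<close>
    have "(\<lambda>n. integral\<^sup>L ((?F ^^ n) \<nu>0) (?T (indicator A))) \<longlonglongrightarrow> integral\<^sup>L \<mu> (?T (indicator A))"
      by (rule \<mu>(2)[OF cyl[OF ind_cyl[OF A]]])
    then have "(\<lambda>n. integral\<^sup>L ((?F ^^ Suc n) \<nu>0) (indicator A)) \<longlonglongrightarrow> integral\<^sup>L (?F \<mu>) (indicator A :: _ \<Rightarrow> real)"
      using integral_pca_step[OF K \<nu>n ind_cyl[OF A]] integral_pca_step[OF K \<mu>(1) ind_cyl[OF A]] by simp
    moreover have "(\<lambda>n. integral\<^sup>L ((?F ^^ Suc n) \<nu>0) (indicator A)) \<longlonglongrightarrow> integral\<^sup>L \<mu> (indicator A :: _ \<Rightarrow> real)"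
      by (rule LIMSEQ_Suc[OF \<mu>(2)[OF ind_cyl[OF A]]])
    ultimately have "integral\<^sup>L (?F \<mu>) (indicator A) = integral\<^sup>L \<mu> (indicator A :: _ \<Rightarrow> real)"
      by (rule LIMSEQ_unique)
    then show "emeasure (?F \<mu>) A = emeasure \<mu> A"
      using ind[OF A F\<mu>] ind[OF A \<mu>(1)] by (simp add: F\<mu>.emeasure_eq_measure \<mu>.emeasure_eq_measure)
  qed simp_all
  moreover have "weakly_converges (\<lambda>n. (?F ^^ n) \<nu>) \<mu>" if \<nu>: "\<nu> \<in> ?P" for \<nu>
    unfolding weakly_converges_def
  proof (intro allI impI LIMSEQ_I)
    fix f :: "config \<Rightarrow> real" and e :: real
    assume f: "continuous_on UNIV f" and "e > 0"
    obtain g where g: "cylindrical g" "\<And>x. \<bar>f x - g x\<bar> < e / 4"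
      using continuous_cylindrical_approx[OF f, of "e / 4"] \<open>e > 0\<close> by auto
    \<comment> \<open>Three errors of size \<open>e / 4\<close> will add up: two from replacing
      \<open>f\<close> by \<open>g\<close>, one from the convergence for \<open>g\<close>.\<close>
    have close: "\<bar>integral\<^sup>L N f - integral\<^sup>L N g\<bar> \<le> e / 4" if N: "N \<in> ?P" for N
    proof -
      obtain B where B: "\<And>x. \<bar>g x\<bar> \<le> B" using cylindrical_bounded[OF g(1)] by blast
      have B': "\<bar>f x\<bar> \<le> B + e / 4" for x using B[of x] g(2)[of x] by linarith
      interpret prob_space N using N by (simp add: space_prob_algebra)
      have s: "sets N = sets borel" using N by (simp add: space_prob_algebra)
      have fm: "f \<in> borel_measurable borel" by (rule borel_measurable_continuous_onI[OF f])
      have gm: "g \<in> borel_measurable borel" by (rule cylindrical_borel_measurable[OF g(1)])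
      have "integrable N f"
        using fm B' by (intro integrable_const_bound[of _ "B + e / 4"]) (simp_all add: measurable_cong_sets[OF s])
      moreover have "integrable N g"
        using gm B by (intro integrable_const_bound[of _ B]) (simp_all add: measurable_cong_sets[OF s])
      ultimately have "integral\<^sup>L N f - integral\<^sup>L N g = integral\<^sup>L N (\<lambda>x. f x - g x)" by simp
      moreover have "\<bar>integral\<^sup>L N (\<lambda>x. f x - g x) - 0\<bar> \<le> e / 4"
        by (rule prob_integral_close[OF N]) (use fm gm g(2) in \<open>auto simp: less_imp_le\<close>)
      ultimately show ?thesis by simp
    qed
    have "(\<lambda>n. integral\<^sup>L ((?F ^^ n) \<nu>) g) \<longlonglongrightarrow> integral\<^sup>L \<mu> g"
      using lim[OF g(1) \<nu>] lim_eq[OF g(1)] by simp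
    from LIMSEQ_D[OF this, of "e / 4"] obtain M where
      M: "\<And>n. n \<ge> M \<Longrightarrow> \<bar>integral\<^sup>L ((?F ^^ n) \<nu>) g - integral\<^sup>L \<mu> g\<bar> < e / 4"
      using \<open>e > 0\<close> by auto
    have "\<bar>integral\<^sup>L ((?F ^^ n) \<nu>) f - integral\<^sup>L \<mu> f\<bar> < e" if "n \<ge> M" for n
      using M[OF that] close[OF pca_iterate_in_prob_algebra[OF K \<nu>], of n] close[OF \<mu>(1)] by linarith
    then show "\<exists>M. \<forall>n\<ge>M. norm (integral\<^sup>L ((?F ^^ n) \<nu>) f - integral\<^sup>L \<mu> f) < e"
      by auto
  qed
  ultimately show ?thesis
    unfolding pca_ergodic_def by (intro bexI[OF _ \<mu>(1)] conjI ballI)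
qed

section \<open>Averaging over independent noise\<close>

text \<open>Randomness sits in an explicit field \<open>u\<close>, so that one field can drive
  several automata at once; couplings rest on this.\<close>

definition update :: "('s \<Rightarrow> 's \<Rightarrow> 'u \<Rightarrow> 't) \<Rightarrow> (int \<Rightarrow> 's) \<Rightarrow> (int \<Rightarrow> 'u) \<Rightarrow> int \<Rightarrow> 't" where
  "update F \<eta> u n = F (\<eta> (n - 1)) (\<eta> n) (u n)"

abbreviation noise :: "'u pmf \<Rightarrow> (int \<Rightarrow> 'u) measure" where
  "noise q \<equiv> PiM UNIV (\<lambda>_. measure_pmf q)"

definition avg :: "'u pmf \<Rightarrow> ('s \<Rightarrow> 's \<Rightarrow> 'u \<Rightarrow> 's) \<Rightarrow> ((int \<Rightarrow> 's) \<Rightarrow> real) \<Rightarrow> (int \<Rightarrow> 's) \<Rightarrow> real" where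
  "avg q F f \<eta> = (\<integral>u. f (update F \<eta> u) \<partial>noise q)"

lemma prob_space_noise: "prob_space (noise q)"
  by (intro prob_space_PiM prob_space_measure_pmf)

lemma cylindrical_update:
  assumes "cylindrical f"
  shows "cylindrical (\<lambda>u. f (update F \<eta> u))"
proof -
  obtain S where S: "finite S" "\<And>x y. (\<And>i. i \<in> S \<Longrightarrow> x i = y i) \<Longrightarrow> f x = f y"
    using assms unfolding cylindrical_def by metis
  show ?thesis
    by (rule cylindricalI[OF S(1)]) (auto intro: S(2) simp: update_def)
qed

lemma cylindrical_avg:
  assumes "cylindrical f"
  shows "cylindrical (avg q F f)"
proof -
  obtain S where S: "finite S" "\<And>x y. (\<And>i. i \<in> S \<Longrightarrow> x i = y i) \<Longrightarrow> f x = f y"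
    using assms unfolding cylindrical_def by metis
  show ?thesis
  proof (rule cylindricalI)
    show "finite (S \<union> (\<lambda>i. i - 1) ` S)" using S(1) by simp
    fix x y :: "int \<Rightarrow> 'a" assume "\<And>i. i \<in> S \<union> (\<lambda>i. i - 1) ` S \<Longrightarrow> x i = y i"
    then have "f (update F x u) = f (update F y u)" for u
      by (intro S(2)) (auto simp: update_def)
    then show "avg q F f x = avg q F f y" by (simp add: avg_def)
  qed
qed

lemma cylindrical_avg_iterate: "cylindrical f \<Longrightarrow> cylindrical ((avg q F ^^ n) f)"
  by (induction n) (auto intro: cylindrical_avg)

lemma avg_iterate_Suc:
  "(avg q F ^^ Suc n) f \<eta> = (\<integral>u. (avg q F ^^ n) f (update F \<eta> u) \<partial>noise q)"
  by (simp add: avg_def[of q F "(avg q F ^^ n) f"])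

context
  fixes q :: "'u::finite pmf" and F :: "'s::finite \<Rightarrow> 's \<Rightarrow> 'u \<Rightarrow> 's"
begin

lemma integrable_update:
  assumes "cylindrical f"
  shows "integrable (noise q) (\<lambda>u. f (update F \<eta> u) :: real)"
proof -
  interpret prob_space "noise q" by (rule prob_space_noise)
  obtain B where "\<And>u. \<bar>f (update F \<eta> u)\<bar> \<le> B"
    using cylindrical_bounded[OF cylindrical_update[OF assms]] by blast
  then show ?thesis
    using cylindrical_measurable[OF cylindrical_update[OF assms]]
    by (intro integrable_const_bound[of _ B]) auto
qed

lemma avg_mono:
  "cylindrical f \<Longrightarrow> cylindrical g \<Longrightarrow> (\<And>\<eta>. f \<eta> \<le> g \<eta>) \<Longrightarrow> avg q F f \<eta> \<le> avg q F g \<eta>"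
  unfolding avg_def by (intro integral_mono integrable_update)

lemma avg_add:
  "cylindrical f \<Longrightarrow> cylindrical g \<Longrightarrow> avg q F (\<lambda>\<eta>. f \<eta> + g \<eta>) = (\<lambda>\<eta>. avg q F f \<eta> + avg q F g \<eta>)"
  unfolding avg_def by (intro ext Bochner_Integration.integral_add integrable_update)

lemma avg_scale: "avg q F (\<lambda>\<eta>. c * f \<eta>) = (\<lambda>\<eta>. c * avg q F f \<eta>)"
  unfolding avg_def by simp

lemma avg_const: "avg q F (\<lambda>\<eta>. c) = (\<lambda>\<eta>. c)"
  unfolding avg_def by (simp add: prob_space.prob_space[OF prob_space_noise])

text \<open>The rule is the same at every site and i.i.d. noise is translation invariant, so the
  operator commutes with shifts.\<close>

lemma avg_shift:
  assumes "cylindrical f"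
  shows "avg q F (\<lambda>\<eta>. f (\<lambda>i. \<eta> (i + k))) = (\<lambda>\<eta>. avg q F f (\<lambda>i. \<eta> (i + k)))"
proof
  fix \<eta>
  have D: "distr (noise q) (noise q) (\<lambda>u i. u (i + k)) = noise q"
    using distr_PiM_reindex[of UNIV "\<lambda>_. measure_pmf q" "\<lambda>i. i + k" UNIV]
    by (simp add: prob_space_measure_pmf restrict_UNIV)
  have "avg q F f (\<lambda>i. \<eta> (i + k)) = (\<integral>u. f (update F (\<lambda>i. \<eta> (i + k)) u) \<partial>distr (noise q) (noise q) (\<lambda>u i. u (i + k)))"
    unfolding D avg_def ..
  also have "\<dots> = (\<integral>u. f (update F (\<lambda>i. \<eta> (i + k)) (\<lambda>i. u (i + k))) \<partial>noise q)"
  proof (rule integral_distr)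
    show "(\<lambda>u i. u (i + k)) \<in> noise q \<rightarrow>\<^sub>M noise q"
      by (intro measurable_PiM_single' measurable_component_singleton) auto
  qed (rule cylindrical_measurable[OF cylindrical_update[OF assms]])
  also have "\<dots> = avg q F (\<lambda>\<eta>. f (\<lambda>i. \<eta> (i + k))) \<eta>"
    by (simp add: avg_def update_def[abs_def] algebra_simps)
  finally show "avg q F (\<lambda>\<eta>. f (\<lambda>i. \<eta> (i + k))) \<eta> = avg q F f (\<lambda>i. \<eta> (i + k))" ..
qed

lemma avg_iterate_mono:
  assumes "cylindrical f" "cylindrical g" "\<And>\<eta>. f \<eta> \<le> g \<eta>"
  shows "(avg q F ^^ n) f \<eta> \<le> (avg q F ^^ n) g \<eta>"
  by (induction n arbitrary: \<eta>)
     (use assms in \<open>auto intro!: avg_mono cylindrical_avg_iterate\<close>)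

lemma avg_iterate_add:
  assumes "cylindrical f" "cylindrical g"
  shows "(avg q F ^^ n) (\<lambda>\<eta>. f \<eta> + g \<eta>) = (\<lambda>\<eta>. (avg q F ^^ n) f \<eta> + (avg q F ^^ n) g \<eta>)"
  by (induction n)
     (use assms in \<open>auto simp: avg_add cylindrical_avg_iterate\<close>)

lemma avg_iterate_scale: "(avg q F ^^ n) (\<lambda>\<eta>. c * f \<eta>) = (\<lambda>\<eta>. c * (avg q F ^^ n) f \<eta>)"
  by (induction n) (auto simp: avg_scale)

lemma avg_iterate_const: "(avg q F ^^ n) (\<lambda>\<eta>. c) = (\<lambda>\<eta>. c)"
  by (induction n) (auto simp: avg_const)

lemma avg_iterate_sum:
  assumes "\<And>i. i \<in> A \<Longrightarrow> cylindrical (f i)"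
  shows "(avg q F ^^ n) (\<lambda>\<eta>. \<Sum>i\<in>A. f i \<eta>) = (\<lambda>\<eta>. \<Sum>i\<in>A. (avg q F ^^ n) (f i) \<eta>)"
  using assms
proof (induction A rule: infinite_finite_induct)
  case (insert i A)
  then show ?case by (simp add: avg_iterate_add cylindrical_sum)
qed (simp_all add: avg_iterate_const)

lemma avg_iterate_shift:
  assumes "cylindrical f"
  shows "(avg q F ^^ n) (\<lambda>\<eta>. f (\<lambda>i. \<eta> (i + k))) = (\<lambda>\<eta>. (avg q F ^^ n) f (\<lambda>i. \<eta> (i + k)))"
  by (induction n) (use assms in \<open>auto simp: avg_shift cylindrical_avg_iterate\<close>)

end

section \<open>The law of one step as a product measure\<close>

lemma PiM_map_pmf:
  "distr (noise q) (PiM UNIV (\<lambda>n. measure_pmf (map_pmf (G n) q))) (\<lambda>u n. G n (u n))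
    = PiM UNIV (\<lambda>n :: int. measure_pmf (map_pmf (G n) q))" (is "distr _ ?M ?t = ?M")
proof (rule measure_eqI_PiM_infinite[symmetric, OF refl])
  show "finite_measure ?M"
    by (intro prob_space.finite_measure prob_space_PiM prob_space_measure_pmf)
  have t: "?t \<in> noise q \<rightarrow>\<^sub>M ?M"
  proof (rule measurable_PiM_single')
    fix i :: int
    show "(\<lambda>u. G i (u i)) \<in> noise q \<rightarrow>\<^sub>M measure_pmf (map_pmf (G i) q)"
      by (rule measurable_compose[OF measurable_component_singleton]) auto
  qed auto
  fix A and J :: "int set" assume J: "finite J"
  let ?e = "prod_emb UNIV (\<lambda>n. measure_pmf (map_pmf (G n) q)) J (Pi\<^sub>E J A)"
  have "?M ?e = (\<Prod>i\<in>J. emeasure (measure_pmf (map_pmf (G i) q)) (A i))"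
    using J by (intro emeasure_PiM_emb prob_space_measure_pmf) auto
  also have "\<dots> = (\<Prod>i\<in>J. emeasure (measure_pmf q) (G i -` A i))"
    by simp
  also have "\<dots> = emeasure (noise q) (prod_emb UNIV (\<lambda>_. measure_pmf q) J (Pi\<^sub>E J (\<lambda>i. G i -` A i)))"
    using J by (intro emeasure_PiM_emb[symmetric] prob_space_measure_pmf) auto
  also have "prod_emb UNIV (\<lambda>_. measure_pmf q) J (Pi\<^sub>E J (\<lambda>i. G i -` A i)) = ?t -` ?e \<inter> space (noise q)"
    by (auto simp: prod_emb_def space_PiM PiE_iff)
  also have "emeasure (noise q) \<dots> = distr (noise q) ?M ?t ?e"
    using t J by (intro emeasure_distr[symmetric]) auto
  finally show "?M ?e = distr (noise q) ?M ?t ?e" .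
qed simp

text \<open>This identifies \<open>avg\<close> with the transition operator of the automaton, and it
  makes one-step expectations of the envelope computable.\<close>

lemma avg_eq_integral_PiM:
  fixes q :: "'u::finite pmf" and F :: "'s::finite \<Rightarrow> 's \<Rightarrow> 'u \<Rightarrow> 's"
  assumes "cylindrical f"
  shows "avg q F f \<eta> = (\<integral>x. f x \<partial>PiM UNIV (\<lambda>n. measure_pmf (map_pmf (F (\<eta> (n - 1)) (\<eta> n)) q)))"
proof -
  let ?M = "PiM UNIV (\<lambda>n. measure_pmf (map_pmf (F (\<eta> (n - 1)) (\<eta> n)) q))"
  have t: "update F \<eta> \<in> noise q \<rightarrow>\<^sub>M ?M"
  proof (rule measurable_PiM_single')
    fix i :: int
    show "(\<lambda>u. update F \<eta> u i) \<in> noise q \<rightarrow>\<^sub>M measure_pmf (map_pmf (F (\<eta> (i - 1)) (\<eta> i)) q)"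
      unfolding update_def by (rule measurable_compose[OF measurable_component_singleton]) auto
  qed auto
  have "(\<integral>x. f x \<partial>?M) = (\<integral>x. f x \<partial>distr (noise q) ?M (update F \<eta>))"
    using PiM_map_pmf[where G = "\<lambda>n. F (\<eta> (n - 1)) (\<eta> n)" and q = q] by (simp add: update_def[abs_def])
  also have "\<dots> = avg q F f \<eta>"
    unfolding avg_def by (rule integral_distr[OF t cylindrical_measurable[OF assms]])
  finally show ?thesis ..
qed

lemma integral_PiM_triple:
  fixes \<kappa> :: "int \<Rightarrow> 's::finite pmf" and v :: "'s \<Rightarrow> 's \<Rightarrow> 's \<Rightarrow> real"
  shows "(\<integral>x. v (x 0) (x 1) (x 2) \<partial>PiM UNIV (\<lambda>n. measure_pmf (\<kappa> n))) =
    (\<Sum>r\<in>UNIV. \<Sum>s\<in>UNIV. \<Sum>t\<in>UNIV. v r s t * (pmf (\<kappa> 0) r * pmf (\<kappa> 1) s * pmf (\<kappa> 2) t))"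
    (is "integral\<^sup>L ?M _ = _")
proof -
  interpret product_prob_space "\<lambda>n. measure_pmf (\<kappa> n)" UNIV
    by unfold_locales
  let ?A = "\<lambda>w :: 's \<times> 's \<times> 's. {x \<in> space ?M. \<forall>i\<in>{0, 1, 2}. x i \<in> (if i = 0 then {fst w} else if i = 1 then {fst (snd w)} else {snd (snd w)})}"
  have m: "?A w \<in> sets ?M" for w
    by measurable
  have em: "emeasure ?M (?A w) = ennreal (pmf (\<kappa> 0) (fst w) * pmf (\<kappa> 1) (fst (snd w)) * pmf (\<kappa> 2) (snd (snd w)))" for w
    by (subst emeasure_PiM_Collect) (auto simp: emeasure_pmf_single ennreal_mult mult.assoc)
  \<comment> \<open>Splitting by the values at the three sites gives a finite sum of cylinder
    indicators, whose measures are products of one-site probabilities.\<close>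
  have "v (x 0) (x 1) (x 2) = (\<Sum>w\<in>UNIV. v (fst w) (fst (snd w)) (snd (snd w)) * indicator (?A w) x)" for x
  proof -
    have "(\<Sum>w\<in>UNIV. v (fst w) (fst (snd w)) (snd (snd w)) * indicator (?A w) x)
        = (\<Sum>w\<in>UNIV. if w = (x 0, x 1, x 2) then v (fst w) (fst (snd w)) (snd (snd w)) else 0)"
      by (intro sum.cong) (auto simp: indicator_def space_PiM)
    then show ?thesis by (simp add: sum.delta)
  qed
  then have "(\<integral>x. v (x 0) (x 1) (x 2) \<partial>?M)
      = (\<integral>x. (\<Sum>w\<in>UNIV. v (fst w) (fst (snd w)) (snd (snd w)) * indicator (?A w) x) \<partial>?M)"
    by (intro Bochner_Integration.integral_cong refl)
  also have "\<dots> = (\<Sum>w\<in>UNIV. v (fst w) (fst (snd w)) (snd (snd w)) * measure ?M (?A w))"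
    using m by (subst Bochner_Integration.integral_sum) (auto simp: P.emeasure_eq_measure)
  also have "\<dots> = (\<Sum>w\<in>UNIV. v (fst w) (fst (snd w)) (snd (snd w)) *
      (pmf (\<kappa> 0) (fst w) * pmf (\<kappa> 1) (fst (snd w)) * pmf (\<kappa> 2) (snd (snd w))))"
    using em by (intro sum.cong) (simp_all add: measure_def)
  also have "\<dots> = (\<Sum>r\<in>UNIV. \<Sum>s\<in>UNIV. \<Sum>t\<in>UNIV. v r s t * (pmf (\<kappa> 0) r * pmf (\<kappa> 1) s * pmf (\<kappa> 2) t))"
    by (simp add: UNIV_Times_UNIV[symmetric] sum.cartesian_product case_prod_unfold del: UNIV_Times_UNIV)
  finally show ?thesis .
qed

section \<open>The envelope automaton\<close>

text \<open>\<^const>\<open>None\<close> is the symbol \<open>?\<close>: the value of the site is not yet determined.\<close>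

definition consistent :: "bool option \<Rightarrow> bool \<Rightarrow> bool" where
  "consistent s b \<longleftrightarrow> s = None \<or> s = Some b"

text \<open>Two copies and the envelope are driven by the same noise. \<open>G\<close> keeps the
  envelope consistent with both, so at time \<open>n\<close> they can differ only where it is
  undetermined; a union bound over \<open>S\<close> does the rest.\<close>

lemma envelope_coupling:
  fixes q :: "'u::finite pmf" and f :: "config \<Rightarrow> real"
  assumes G: "\<And>x y a b u. consistent x a \<Longrightarrow> consistent y b \<Longrightarrow> consistent (G x y u) (g a b u)"
    and S: "finite S" "\<And>\<eta> \<eta>'. (\<And>i. i \<in> S \<Longrightarrow> \<eta> i = \<eta>' i) \<Longrightarrow> f \<eta> = f \<eta>'"
    and D: "\<And>\<eta> \<eta>'. \<bar>f \<eta> - f \<eta>'\<bar> \<le> D"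
    and \<eta>: "\<And>i. consistent (\<xi> i) (\<eta> i)" "\<And>i. consistent (\<xi> i) (\<eta>' i)"
  shows "\<bar>(avg q g ^^ n) f \<eta> - (avg q g ^^ n) f \<eta>'\<bar>
    \<le> (avg q G ^^ n) (\<lambda>\<xi>. \<Sum>i\<in>S. D * of_bool (\<xi> i = None)) \<xi>"
  using \<eta>
proof (induction n arbitrary: \<eta> \<eta>' \<xi>)
  case 0
  have "D \<ge> 0" using D[of undefined undefined] by simp
  show ?case
  proof (cases "\<exists>i\<in>S. \<xi> i = None")
    case True
    then obtain i where i: "i \<in> S" "\<xi> i = None" by blast
    have "D * of_bool (\<xi> i = None) \<le> (\<Sum>i\<in>S. D * of_bool (\<xi> i = None))"
      using S(1) i(1) \<open>D \<ge> 0\<close> by (intro member_le_sum) auto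
    then show ?thesis using D[of \<eta> \<eta>'] i by simp
  next
    case False
    then have "\<eta> i = \<eta>' i" if "i \<in> S" for i
      using 0(1)[of i] 0(2)[of i] that by (auto simp: consistent_def)
    then have "f \<eta> = f \<eta>'" by (rule S(2))
    then show ?thesis using \<open>D \<ge> 0\<close> by (auto intro: sum_nonneg)
  qed
next
  case (Suc n)
  let ?d = "\<lambda>\<xi>. \<Sum>i\<in>S. D * of_bool (\<xi> i = None)"
  have f: "cylindrical f" by (rule cylindricalI[OF S])
  have d: "cylindrical ?d"
    by (intro cylindrical_sum cylindrical_comp[where F = "\<lambda>x. D * of_bool (x = None)"] cylindrical_coord)
  note int = integrable_update[OF cylindrical_avg_iterate[OF f]]
  have "\<bar>(avg q g ^^ Suc n) f \<eta> - (avg q g ^^ Suc n) f \<eta>'\<bar>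
      = \<bar>\<integral>u. (avg q g ^^ n) f (update g \<eta> u) - (avg q g ^^ n) f (update g \<eta>' u) \<partial>noise q\<bar>"
    unfolding avg_iterate_Suc by (simp add: int)
  also have "\<dots> \<le> (\<integral>u. \<bar>(avg q g ^^ n) f (update g \<eta> u) - (avg q g ^^ n) f (update g \<eta>' u)\<bar> \<partial>noise q)"
    by (rule integral_abs_bound)
  also have "\<dots> \<le> (\<integral>u. (avg q G ^^ n) ?d (update G \<xi> u) \<partial>noise q)"
  proof (rule integral_mono)
    show "integrable (noise q) (\<lambda>u. (avg q G ^^ n) ?d (update G \<xi> u))"
      by (rule integrable_update[OF cylindrical_avg_iterate[OF d]])
    show "integrable (noise q) (\<lambda>u. \<bar>(avg q g ^^ n) f (update g \<eta> u) - (avg q g ^^ n) f (update g \<eta>' u)\<bar>)"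
      by (rule integrable_abs[OF Bochner_Integration.integrable_diff[OF int int]])
    show "\<bar>(avg q g ^^ n) f (update g \<eta> u) - (avg q g ^^ n) f (update g \<eta>' u)\<bar> \<le> (avg q G ^^ n) ?d (update G \<xi> u)" for u
      by (rule Suc.IH) (auto simp: update_def intro!: G Suc.prems)
  qed
  finally show ?case unfolding avg_iterate_Suc .
qed

text \<open>A Lyapunov argument with potential \<open>v\<close> and flux \<open>h\<close>. The flux
  terms cancel in expectation because the start is translation invariant. The expected potential is
  bounded below and falls by at least \<open>e\<close> times the density in every step.\<close>

lemma unknown_density_tendsto_0:
  fixes q :: "'u::finite pmf" and G :: "bool option \<Rightarrow> bool option \<Rightarrow> 'u \<Rightarrow> bool option"
    and v h :: "bool option \<Rightarrow> bool option \<Rightarrow> bool option \<Rightarrow> real"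
  defines "\<kappa> \<equiv> \<lambda>a b. map_pmf (G a b) q"
  assumes "e > 0" and drift: "\<And>a b c d.
    (\<Sum>r\<in>UNIV. \<Sum>s\<in>UNIV. \<Sum>t\<in>UNIV. v r s t * (pmf (\<kappa> a b) r * pmf (\<kappa> b c) s * pmf (\<kappa> c d) t))
      \<le> v a b c - e * of_bool (a = None) + h b c d - h a b c"
  shows "(\<lambda>n. (avg q G ^^ n) (\<lambda>\<xi>. of_bool (\<xi> 0 = None)) (\<lambda>_. None)) \<longlonglongrightarrow> 0"
proof -
  define E where "E n f = (avg q G ^^ n) f (\<lambda>_. None)" for n and f :: "(int \<Rightarrow> bool option) \<Rightarrow> real"
  define V where "V \<xi> = v (\<xi> 0) (\<xi> 1) (\<xi> 2)" for \<xi> :: "int \<Rightarrow> bool option"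
  define H where "H \<xi> = h (\<xi> 0) (\<xi> 1) (\<xi> 2)" for \<xi> :: "int \<Rightarrow> bool option"
  define d where "d \<xi> = (of_bool (\<xi> 0 = None) :: real)" for \<xi> :: "int \<Rightarrow> bool option"
  \<comment> \<open>Sites \<open>0\<close>, \<open>1\<close>, \<open>2\<close> after a step depend
    on sites \<open>-1\<close> to \<open>2\<close> before it. The drift bound is applied to that
    window, so its terms in \<open>a\<close>, \<open>b\<close>, \<open>c\<close> are read one site
    further left.\<close>
  define sh where "sh f \<xi> = f (\<lambda>i. \<xi> (i + (- 1)))" for f :: "_ \<Rightarrow> real" and \<xi> :: "int \<Rightarrow> bool option"
  have cyl: "cylindrical V" "cylindrical H" "cylindrical d"
    unfolding V_def H_def d_def by (rule cylindricalI[of "{0, 1, 2}"]; simp)+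
  have cyl_sh: "cylindrical (sh f)" if "cylindrical f" for f
    unfolding sh_def using cylindrical_shift[OF that] .
  have E_sh: "E n (sh f) = E n f" if "cylindrical f" for n f
    unfolding E_def sh_def avg_iterate_shift[OF that] ..
  let ?R = "\<lambda>\<xi>. (sh V \<xi> + (- e) * sh d \<xi>) + (H \<xi> + (- 1) * sh H \<xi>)"
  have cyl1: "cylindrical (\<lambda>\<xi>. (- e) * sh d \<xi>)" "cylindrical (\<lambda>\<xi>. (- 1) * sh H \<xi>)"
    by (intro cylindrical_comp[where F = "(*) _"] cyl_sh cyl)+
  have cyl2: "cylindrical (\<lambda>\<xi>. sh V \<xi> + (- e) * sh d \<xi>)" "cylindrical (\<lambda>\<xi>. H \<xi> + (- 1) * sh H \<xi>)"
    by (intro cylindrical_comp2[where F = "(+)"] cyl_sh cyl cyl1)+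
  have "avg q G V \<xi> \<le> ?R \<xi>" for \<xi>
  proof -
    have "avg q G V \<xi> = (\<integral>x. v (x 0) (x 1) (x 2) \<partial>PiM UNIV (\<lambda>n. measure_pmf (\<kappa> (\<xi> (n - 1)) (\<xi> n))))"
      unfolding avg_eq_integral_PiM[OF cyl(1)] by (simp add: V_def[abs_def] \<kappa>_def)
    also have "\<dots> \<le> ?R \<xi>"
      unfolding integral_PiM_triple[where v = v] using drift[of "\<xi> (- 1)" "\<xi> 0" "\<xi> 1" "\<xi> 2"]
      by (simp add: sh_def V_def H_def d_def algebra_simps)
    finally show ?thesis .
  qed
  then have "E n (avg q G V) \<le> E n ?R" for n
    unfolding E_def
    by (intro avg_iterate_mono cylindrical_avg cyl cylindrical_comp2[where F = "(+)"] cyl2)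
  moreover have "E n ?R = E n V - e * E n d" for n
    using E_sh[OF cyl(1), of n] E_sh[OF cyl(2), of n] E_sh[OF cyl(3), of n] cyl cyl_sh
    unfolding E_def avg_iterate_add[OF cyl2] avg_iterate_add[OF cyl_sh[OF cyl(1)] cyl1(1)]
      avg_iterate_add[OF cyl(2) cyl1(2)] avg_iterate_scale by simp
  ultimately have step: "E (Suc n) V \<le> E n V - e * E n d" for n
    by (simp add: E_def funpow_swap1)
  have sum: "e * (\<Sum>i<n. E i d) \<le> E 0 V - E n V" for n
  proof (induction n)
    case (Suc n)
    then show ?case using step[of n] by (simp add: algebra_simps)
  qed simp
  obtain B where B: "\<And>\<xi>. \<bar>V \<xi>\<bar> \<le> B" using cylindrical_bounded[OF cyl(1)] by blast
  have EV: "E n V \<ge> - B" for n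
  proof -
    have "E n (\<lambda>_. - B) \<le> E n V"
      unfolding E_def using B by (intro avg_iterate_mono cylindrical_const cyl) (simp add: abs_le_iff minus_le_iff)
    then show ?thesis by (simp add: E_def avg_iterate_const)
  qed
  have nonneg: "E n d \<ge> 0" for n
  proof -
    have "E n (\<lambda>_. 0) \<le> E n d"
      unfolding E_def by (intro avg_iterate_mono cylindrical_const cyl) (simp add: d_def)
    then show ?thesis by (simp add: E_def avg_iterate_const)
  qed
  have "(\<Sum>i<n. E i d) \<le> (E 0 V + B) / e" for n
    using sum[of n] EV[of n] \<open>e > 0\<close> by (simp add: field_simps)
  with nonneg have "summable (\<lambda>i. E i d)"
    by (intro summableI_nonneg_bounded)
  then have "(\<lambda>i. E i d) \<longlonglongrightarrow> 0" by (rule summable_LIMSEQ_zero)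
  then show ?thesis by (simp add: E_def d_def[abs_def])
qed

text \<open>By coupling, the oscillation for a function of the sites in \<open>S\<close> is at most
  \<open>2 * B\<close> times the summed densities of undetermined sites over \<open>S\<close>; by
  translation invariance these all equal the density at site \<open>0\<close>.\<close>

lemma pca_ergodic_if_envelope:
  fixes q :: "'u::finite pmf" and G :: "bool option \<Rightarrow> bool option \<Rightarrow> 'u \<Rightarrow> bool option"
  assumes \<phi>: "\<And>\<eta> n. \<phi> \<eta> n = map_pmf (g (\<eta> (n - 1)) (\<eta> n)) q"
    and G: "\<And>x y a b u. consistent x a \<Longrightarrow> consistent y b \<Longrightarrow> consistent (G x y u) (g a b u)"
    and density: "(\<lambda>n. (avg q G ^^ n) (\<lambda>\<xi>. of_bool (\<xi> 0 = None)) (\<lambda>_. None)) \<longlonglongrightarrow> 0"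
  shows "pca_ergodic \<phi>"
proof (rule pca_ergodicI)
  show "pca_kernel \<phi> \<in> borel \<rightarrow>\<^sub>M prob_algebra borel"
  proof (rule measurable_pca_kernel)
    show "(\<lambda>\<eta>. \<phi> \<eta> n) \<in> borel \<rightarrow>\<^sub>M count_space UNIV" for n
      unfolding \<phi> by (rule measurable_two_sites[where g = "\<lambda>a b. map_pmf (g a b) q"])
  qed
  have op: "pca_operator \<phi> f = avg q g f" if "cylindrical f" for f
    unfolding pca_operator_def[abs_def] pca_kernel_def \<phi> avg_eq_integral_PiM[OF that, abs_def] ..
  then show "cylindrical (pca_operator \<phi> f)" if "cylindrical f" for f
    using that by (simp add: cylindrical_avg)
  have opn: "(pca_operator \<phi> ^^ n) f = (avg q g ^^ n) f" if "cylindrical f" for f n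
    by (induction n) (simp_all add: op cylindrical_avg_iterate that)
  fix f :: "config \<Rightarrow> real" assume f: "cylindrical f"
  obtain S where S: "finite S" "\<And>x y. (\<And>i. i \<in> S \<Longrightarrow> x i = y i) \<Longrightarrow> f x = f y"
    using f unfolding cylindrical_def by metis
  obtain B where B: "\<And>x. \<bar>f x\<bar> \<le> B" using cylindrical_bounded[OF f] by blast
  have D: "\<bar>f x - f y\<bar> \<le> 2 * B" for x y using B[of x] B[of y] by linarith
  let ?E = "\<lambda>n. (avg q G ^^ n) (\<lambda>\<xi>. of_bool (\<xi> 0 = None)) (\<lambda>_. None)"
  have "\<bar>(pca_operator \<phi> ^^ n) f \<eta> - (pca_operator \<phi> ^^ n) f \<eta>'\<bar> \<le> (\<Sum>i\<in>S. 2 * B * ?E n)" for n \<eta> \<eta>'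
  proof -
    have cyl: "cylindrical (\<lambda>\<xi>. of_bool (\<xi> i = None) :: real)" for i :: int
      by (intro cylindrical_comp[where F = "\<lambda>x. of_bool (x = None)"] cylindrical_coord)
    have site: "(avg q G ^^ n) (\<lambda>\<xi>. of_bool (\<xi> i = None)) (\<lambda>_. None) = ?E n" for i
      using fun_cong[OF avg_iterate_shift[OF cyl[of 0], where q = q and F = G and n = n and k = i], of "\<lambda>_. None"] by simp
    have "\<bar>(avg q g ^^ n) f \<eta> - (avg q g ^^ n) f \<eta>'\<bar>
        \<le> (avg q G ^^ n) (\<lambda>\<xi>. \<Sum>i\<in>S. 2 * B * of_bool (\<xi> i = None)) (\<lambda>_. None)"
      by (rule envelope_coupling[OF G S D]) (auto simp: consistent_def)
    also have "\<dots> = (\<Sum>i\<in>S. (avg q G ^^ n) (\<lambda>\<xi>. 2 * B * of_bool (\<xi> i = None)) (\<lambda>_. None))"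
      by (subst avg_iterate_sum) (auto intro!: cylindrical_comp[where F = "(*) _"] cyl)
    also have "\<dots> = (\<Sum>i\<in>S. 2 * B * ?E n)"
      unfolding avg_iterate_scale by (intro sum.cong refl arg_cong[where f = "(*) _"] site)
    finally show ?thesis unfolding opn[OF f] .
  qed
  moreover have "(\<lambda>n. \<Sum>i\<in>S. 2 * B * ?E n) \<longlonglongrightarrow> (\<Sum>i\<in>S. 2 * B * 0)"
    by (intro tendsto_intros density)
  ultimately show "\<exists>c. c \<longlonglongrightarrow> 0 \<and>
      (\<forall>n \<eta> \<eta>'. \<bar>(pca_operator \<phi> ^^ n) f \<eta> - (pca_operator \<phi> ^^ n) f \<eta>'\<bar> \<le> c n)"
    by (intro exI[of _ "\<lambda>n. \<Sum>i\<in>S. 2 * B * ?E n"]) simp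
qed

section \<open>Noisy NAND\<close>

definition force :: "bool option \<Rightarrow> bool \<Rightarrow> bool" where
  "force u a = (case u of None \<Rightarrow> a | Some b \<Rightarrow> b)"

definition force3 :: "bool option \<Rightarrow> bool option \<Rightarrow> bool option" where
  "force3 u x = (case u of None \<Rightarrow> x | Some b \<Rightarrow> Some b)"

text \<open>Strong Kleene NAND: one input known to be \<open>False\<close> settles the
  output.\<close>

definition nand3 :: "bool option \<Rightarrow> bool option \<Rightarrow> bool option" where
  "nand3 x y = (if x = Some False \<or> y = Some False then Some True
    else if x = None \<or> y = None then None else Some False)"

text \<open>Encodes a channel as resampling: with probability \<open>2 * p\<close> the bit is
  replaced by a fair coin. A resampled bit carries no memory, so it is known even where the envelope
  was not.\<close>

definition forcing :: "real \<Rightarrow> bool option pmf" where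
  "forcing p = bind_pmf (bernoulli_pmf (2 * p))
    (\<lambda>c. if c then map_pmf Some (bernoulli_pmf (1 / 2)) else return_pmf None)"

lemma consistent_force: "consistent x a \<Longrightarrow> consistent (force3 u x) (force u a)"
  by (auto simp: consistent_def force_def force3_def split: option.split)

lemma consistent_nand: "consistent x a \<Longrightarrow> consistent y b \<Longrightarrow> consistent (nand3 x y) (nand a b)"
  by (auto simp: consistent_def nand_def nand3_def)

lemma UNIV_bool_option: "UNIV = {None, Some False, Some True}"
  by (auto simp: UNIV_option_conv UNIV_bool)

lemma pmf_forcing:
  assumes "0 \<le> p" "p \<le> 1 / 2"
  shows "pmf (forcing p) None = 1 - 2 * p" "pmf (forcing p) (Some b) = p"
proof -
  have s: "pmf (map_pmf Some (bernoulli_pmf (1 / 2))) (Some b) = 1 / 2"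
    by (subst pmf_map_inj') (auto simp: pmf_bernoulli_True pmf_bernoulli_False intro: bool.induct)
  have n: "pmf (map_pmf Some (bernoulli_pmf (1 / 2))) None = 0"
    by (simp add: pmf_eq_0_set_pmf)
  show "pmf (forcing p) None = 1 - 2 * p" "pmf (forcing p) (Some b) = p"
    using assms by (simp_all add: forcing_def pmf_bind s n)
qed

lemma pmf_map_finite:
  fixes q :: "'a::finite pmf"
  shows "pmf (map_pmf f q) y = (\<Sum>x\<in>UNIV. of_bool (f x = y) * pmf q x)"
proof -
  have "pmf (map_pmf f q) y = (\<Sum>x\<in>f -` {y}. pmf q x)"
    by (simp add: pmf_map measure_measure_pmf_finite)
  also have "\<dots> = (\<Sum>x\<in>UNIV. of_bool (f x = y) * pmf q x)"
    by (intro sum.mono_neutral_cong_left) auto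
  finally show ?thesis .
qed

text \<open>A flip means that the noise forces the bit opposite to \<open>a\<close>, which has
  probability \<open>p\<close>.\<close>

lemma bsc_eq_forcing:
  assumes "0 \<le> p" "p \<le> 1 / 2"
  shows "bsc p a = map_pmf (\<lambda>u. force u a) (forcing p)"
proof (rule pmf_eqI)
  fix b
  show "pmf (bsc p a) b = pmf (map_pmf (\<lambda>u. force u a) (forcing p)) b"
    using assms
    by (cases a; cases b)
       (simp_all add: bsc_def pmf_map_finite UNIV_bool_option UNIV_bool force_def pmf_forcing)
qed

text \<open>
  The patterns \<open>?\<close>, \<open>1?\<close>, \<open>01?\<close>, \<open>10?\<close> and their mirror images
  have the weights \<open>2\<close>, \<open>\<alpha>\<close>, \<open>1\<close>, \<open>\<beta>\<close>. At \<open>p = 0\<close> (\<open>\<alpha> = 1\<close>, \<open>\<beta> = 0\<close>) this is twice the length of a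
  block of \<open>?\<close>, corrected so that it does not change when the ends of the block, \<open>0?\<close> and \<open>11?\<close>,
  alternate. The terms of order \<open>p\<close> come from a linear program.
\<close>

definition weight :: "real \<Rightarrow> real \<Rightarrow> bool option \<Rightarrow> bool option \<Rightarrow> bool option \<Rightarrow> real" where
  "weight \<alpha> \<beta> r s t = 2 * of_bool (r = None)
    + \<alpha> * of_bool ((r, s) \<in> {(Some True, None), (None, Some True)})
    + of_bool ((r, s, t) \<in> {(Some False, Some True, None), (None, Some True, Some False)})
    + \<beta> * of_bool ((r, s, t) \<in> {(Some True, Some False, None), (None, Some False, Some True)})"

text \<open>Every pattern constrains the first site; second and third sites left free sum out to
  mass one, which is why \<open>N\<close> is needed only for \<open>B\<close> and
  \<open>C\<close>.\<close>

lemma expectation_weight: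
  fixes A B C :: "bool option pmf"
  shows "(\<Sum>r\<in>UNIV. \<Sum>s\<in>UNIV. \<Sum>t\<in>UNIV. weight \<alpha> \<beta> r s t * (pmf A r * pmf B s * pmf C t)) =
    2 * pmf A None
    + \<alpha> * (pmf A (Some True) * pmf B None + pmf A None * pmf B (Some True))
    + (pmf A (Some False) * pmf B (Some True) * pmf C None
      + pmf A None * pmf B (Some True) * pmf C (Some False))
    + \<beta> * (pmf A (Some True) * pmf B (Some False) * pmf C None
      + pmf A None * pmf B (Some False) * pmf C (Some True))"
proof -
  have N: "pmf P None = 1 - pmf P (Some False) - pmf P (Some True)" for P :: "bool option pmf"
  proof -
    have "sum (pmf P) UNIV = 1" by (rule sum_pmf_eq_1) auto
    then show ?thesis by (simp add: UNIV_bool_option)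
  qed
  show ?thesis
    by (simp add: UNIV_bool_option weight_def N[of B] N[of C] algebra_simps)
qed

text \<open>
  The drift inequality holds only up to a coboundary. The two functions below are, up to higher powers
  of \<open>p\<close>, maximal path weights in the de Bruijn graph on triples whose edges carry the drift.
\<close>

definition vertex_flux :: "real \<Rightarrow> bool option \<Rightarrow> bool option \<Rightarrow> bool option \<Rightarrow> real" where
  "vertex_flux p a b c = (case (a, b, c) of
      (Some _, Some True, None) \<Rightarrow> p
    | (Some False, None, Some False) \<Rightarrow> 0
    | (Some False, None, _) \<Rightarrow> p
    | (Some True, None, Some False) \<Rightarrow> 2 * p
    | (Some True, None, _) \<Rightarrow> 3 * p
    | (None, Some False, _) \<Rightarrow> 2 - 4 * p
    | (None, Some True, Some True) \<Rightarrow> 1 + p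
    | (None, _, _) \<Rightarrow> 1
    | _ \<Rightarrow> 0)"

definition edge_flux :: "real \<Rightarrow> bool option \<Rightarrow> bool option \<Rightarrow> bool option \<Rightarrow> real" where
  "edge_flux p a b c = (case (a, b, c) of
      (Some False, Some False, None) \<Rightarrow> 2 * p ^ 2
    | (Some False, Some True, None) \<Rightarrow> p
    | (Some True, Some False, None) \<Rightarrow> p
    | (Some True, Some True, None) \<Rightarrow> 2 * p
    | (Some False, None, _) \<Rightarrow> p + 4 * p ^ 2
    | (Some True, None, Some False) \<Rightarrow> 4 * p
    | (Some True, None, _) \<Rightarrow> 6 * p - 4 * p ^ 2
    | (None, Some False, Some True) \<Rightarrow> 2 - 2 * p
    | (None, Some False, _) \<Rightarrow> 2 - 3 * p + p ^ 2
    | (None, Some True, Some False) \<Rightarrow> 1 + 2 * p + 2 * p ^ 2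
    | (None, Some True, Some True) \<Rightarrow> 1 + 4 * p
    | (None, None, Some True) \<Rightarrow> 1 + 2 * p + p ^ 2
    | (None, _, _) \<Rightarrow> 1 + 2 * p
    | _ \<Rightarrow> 0)"

section \<open>Drift inequalities for the two automata\<close>

lemma bool_option_cases:
  obtains "x = None" | "x = Some False" | "x = Some True"
  by (metis (full_types) not_None_eq)

text \<open>Forcing acts on the output of \<open>nand3\<close>. With \<alpha> = \<open>1 + p\<close>
  and \<beta> = \<open>0\<close> the drift bound is a finite check: one polynomial inequality in
  \<open>p\<close> for each of the 81 windows of four symbols.\<close>

lemma pca_ergodic_vertex_noise:
  assumes "0 < p" "p < 1 / 20"
  shows "pca_ergodic (vertex_noise p)"
proof (rule pca_ergodic_if_envelope)
  show "vertex_noise p \<eta> n = map_pmf (\<lambda>u. force u (nand (\<eta> (n - 1)) (\<eta> n))) (forcing p)" for \<eta> n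
    using assms by (simp add: vertex_noise_def bsc_eq_forcing)
  show "consistent (force3 u (nand3 x y)) (force u (nand a b))"
    if "consistent x a" "consistent y b" for x y a b u
    using that by (intro consistent_force consistent_nand)
  show "(\<lambda>n. (avg (forcing p) (\<lambda>x y u. force3 u (nand3 x y)) ^^ n) (\<lambda>\<xi>. of_bool (\<xi> 0 = None)) (\<lambda>_. None))
    \<longlonglongrightarrow> 0"
  proof (rule unknown_density_tendsto_0)
    show "0 < p / 2" using assms by simp
    have \<kappa>: "pmf (map_pmf (\<lambda>u. force3 u x) (forcing p)) None = (if x = None then 1 - 2 * p else 0)"
      "pmf (map_pmf (\<lambda>u. force3 u x) (forcing p)) (Some b) = (if x = Some b then 1 - p else p)" for x b
      using assms by (cases b; auto simp: pmf_map_finite UNIV_bool_option force3_def pmf_forcing)+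
    \<comment> \<open>After \<open>algebra_simps\<close> the powers of \<open>p\<close> are
      right-nested products, which \<open>linarith\<close> treats as separate unknowns. Each is
      bounded by \<open>1 / 20\<close> of the preceding power, using
      \<open>p < 1 / 20\<close>.\<close>
    have pw: "p * p \<le> p / 20" "p * (p * p) \<le> p * p / 20" "p * (p * (p * p)) \<le> p * (p * p) / 20"
      "p * p > 0" "p * (p * p) > 0" "p * (p * (p * p)) > 0"
      using assms by simp_all
    show "(\<Sum>r\<in>UNIV. \<Sum>s\<in>UNIV. \<Sum>t\<in>UNIV. weight (1 + p) 0 r s t *
        (pmf (map_pmf (\<lambda>u. force3 u (nand3 a b)) (forcing p)) r *
         pmf (map_pmf (\<lambda>u. force3 u (nand3 b c)) (forcing p)) s *
         pmf (map_pmf (\<lambda>u. force3 u (nand3 c d)) (forcing p)) t))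
      \<le> weight (1 + p) 0 a b c - p / 2 * of_bool (a = None) + vertex_flux p b c d - vertex_flux p a b c" for a b c d
      unfolding expectation_weight
      by (cases a rule: bool_option_cases; cases b rule: bool_option_cases;
          cases c rule: bool_option_cases; cases d rule: bool_option_cases;
          simp add: \<kappa> nand3_def weight_def vertex_flux_def algebra_simps;
          use pw assms in linarith)
  qed
qed

text \<open>Forcing acts on the inputs. A site feeds two outputs through separate channels, so each
  output site owns a pair of forcing symbols, and outputs stay independent given the
  configuration.\<close>

lemma pca_ergodic_edge_noise:
  assumes "0 < p" "p < 1 / 20"
  shows "pca_ergodic (edge_noise p)"
proof (rule pca_ergodic_if_envelope)
  let ?q = "pair_pmf (forcing p) (forcing p)"
  let ?G = "\<lambda>x y u. nand3 (force3 (fst u) x) (force3 (snd u) y)"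
  show "edge_noise p \<eta> n = map_pmf (\<lambda>u. nand (force (fst u) (\<eta> (n - 1))) (force (snd u) (\<eta> n))) ?q" for \<eta> n
    using assms
    by (simp add: edge_noise_def bsc_eq_forcing map_pair[symmetric] pmf.map_comp o_def case_prod_unfold)
  show "consistent (?G x y u) (nand (force (fst u) a) (force (snd u) b))"
    if "consistent x a" "consistent y b" for x y a b u
    using that by (intro consistent_force consistent_nand)
  show "(\<lambda>n. (avg ?q ?G ^^ n) (\<lambda>\<xi>. of_bool (\<xi> 0 = None)) (\<lambda>_. None)) \<longlonglongrightarrow> 0"
  proof (rule unknown_density_tendsto_0)
    show "0 < p ^ 2 / 2" using assms by simp
    \<comment> \<open>\<open>?lo x\<close> is the chance that an input is certainly
      \<open>True\<close> after forcing, \<open>?hi x\<close> that it is not certainly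
      \<open>False\<close>. The output is \<open>Some False\<close> if both inputs are certainly
      \<open>True\<close>, and \<open>Some True\<close> if at least one is certainly
      \<open>False\<close>.\<close>
    let ?lo = "\<lambda>x. if x = Some True then 1 - p else p"
    let ?hi = "\<lambda>x. if x = Some False then p else 1 - p"
    have \<kappa>: "pmf (map_pmf (?G x y) ?q) (Some False) = ?lo x * ?lo y"
      "pmf (map_pmf (?G x y) ?q) (Some True) = 1 - ?hi x * ?hi y"
      "pmf (map_pmf (?G x y) ?q) None = ?hi x * ?hi y - ?lo x * ?lo y" for x y
      using assms
      by (cases x rule: bool_option_cases; cases y rule: bool_option_cases;
          simp add: pmf_map_finite UNIV_Times_UNIV[symmetric] UNIV_bool_option force3_def nand3_def
            pmf_pair pmf_forcing algebra_simps del: UNIV_Times_UNIV)+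
    \<comment> \<open>Three output probabilities of degree two and the factor \<beta> =
      \<open>2 * p\<close> lead to powers of \<open>p\<close> up to the seventh.\<close>
    have pw: "p * p \<le> p / 20" "p * (p * p) \<le> p * p / 20" "p * (p * (p * p)) \<le> p * (p * p) / 20"
      "p * (p * (p * (p * p))) \<le> p * (p * (p * p)) / 20"
      "p * (p * (p * (p * (p * p)))) \<le> p * (p * (p * (p * p))) / 20"
      "p * (p * (p * (p * (p * (p * p))))) \<le> p * (p * (p * (p * (p * p)))) / 20"
      "p * p > 0" "p * (p * p) > 0" "p * (p * (p * p)) > 0" "p * (p * (p * (p * p))) > 0"
      "p * (p * (p * (p * (p * p)))) > 0" "p * (p * (p * (p * (p * (p * p))))) > 0"
      using assms by simp_all
    show "(\<Sum>r\<in>UNIV. \<Sum>s\<in>UNIV. \<Sum>t\<in>UNIV. weight (1 + 2 * p) (2 * p) r s t *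
        (pmf (map_pmf (?G a b) ?q) r * pmf (map_pmf (?G b c) ?q) s * pmf (map_pmf (?G c d) ?q) t))
      \<le> weight (1 + 2 * p) (2 * p) a b c - p ^ 2 / 2 * of_bool (a = None) + edge_flux p b c d - edge_flux p a b c"
      for a b c d
      unfolding expectation_weight \<kappa>
      by (cases a rule: bool_option_cases; cases b rule: bool_option_cases;
          cases c rule: bool_option_cases; cases d rule: bool_option_cases;
          simp add: weight_def edge_flux_def power2_eq_square algebra_simps;
          use pw assms in linarith)
  qed
qed

theorem theorem10:
  shows "(\<exists>\<epsilon>>0. \<forall>p\<in>{0..1/2}. p \<in> {0<..<\<epsilon>} \<longrightarrow> pca_ergodic (vertex_noise p)) \<and>
         (\<exists>\<epsilon>>0. \<forall>p\<in>{0..1/2}. p \<in> {0<..<\<epsilon>} \<longrightarrow> pca_ergodic (edge_noise p))"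
  by (intro conjI exI[of _ "1 / 20 :: real"]) (auto intro: pca_ergodic_vertex_noise pca_ergodic_edge_noise)

end
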